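(* Let $d\ge1$, $0<p,q\le\infty$ and $t\in\mathbb{R}$ be fixed. If $0<p_0,q_0\le\infty$ and $t_0\in\mathbb{R}$ are such that $B^{t_0}_{p_0,q_0}(\mathbb{R}^d)\hookrightarrow S^t_{p,q}B(\mathbb{R}^d)$, then $B^{t_0}_{p_0,q_0}(\mathbb{R}^d)\hookrightarrow B^{td}_{p,q}(\mathbb{R}^d)$. (That is, within all spaces $B^{t_0}_{p_0,q_0}(\mathbb{R}^d)$ continuously embedded into $S^t_{p,q}B(\mathbb{R}^d)$, the class $B^{td}_{p,q}(\mathbb{R}^d)$ is the largest one.)
   Context: Isotropic Besov spaces: let $\psi_0\in C_0^\infty(\mathbb{R}^d)$ with $\psi_0(x)=1$ if $\max_i|x_i|\le1$ and $\psi_0(x)=0$ if $\max_i|x_i|\ge 3/2$, and $\psi_j(x)=\psi_0(2^{-j}x)-\psi_0(2^{-j+1}x)$, $j\in\mathbb{N}$. For $s\in\mathbb{R}$, $0<p,q\le\infty$, $B^s_{p,q}(\mathbb{R}^d)$ is the set of tempered distributions $f$ with $\big(\sum_{j\ge0}2^{jsq}\|\mathcal{F}^{-1}[\psi_j\mathcal{F}f]\|_{L_p}^q\big)^{1/q}<\infty$ (modification if $q=\infty$), $\mathcal{F}$ the Fourier transform. Dominating mixed spaces: let $\varphi_0\in C_0^\infty(\mathbb{R})$ with $\varphi_0=1$ on $[-1,1]$, $\operatorname{supp}\varphi_0\subset[-3/2,3/2]$, $\varphi_j(s)=\varphi_0(2^{-j}s)-\varphi_0(2^{-j+1}s)$,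 and $\varphi_{\bar k}(x)=\prod_{i=1}^d\varphi_{k_i}(x_i)$, $|\bar k|=k_1+\dots+k_d$. $S^t_{p,q}B(\mathbb{R}^d)$ is the set of tempered distributions $f$ with $\big(\sum_{\bar k\in\mathbb{N}_0^d}2^{|\bar k|tq}\|\mathcal{F}^{-1}[\varphi_{\bar k}\mathcal{F}f]\|_{L_p}^q\big)^{1/q}<\infty$. $\hookrightarrow$ is a continuous embedding. *)

theory Defs
  imports "HOL-Analysis.Analysis" "HOL-Probability.Essential_Supremum"
begin

type_synonym 'n test = "real^'n \<Rightarrow> complex"
type_synonym 'n distr = "'n test \<Rightarrow> complex"

definition partial :: "'n::finite \<Rightarrow> 'n test \<Rightarrow> 'n test" where
  "partial i g x = vector_derivative (\<lambda>t. g (x + t *\<^sub>R axis i 1)) (at 0)"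

fun Dpar :: "'n::finite list \<Rightarrow> 'n test \<Rightarrow> 'n test" where
  "Dpar [] g = g"
| "Dpar (i # ds) g = partial i (Dpar ds g)"

definition smooth :: "('n::finite) test \<Rightarrow> bool" where
  "smooth g \<longleftrightarrow> (\<forall>ds. continuous_on UNIV (Dpar ds g)) \<and>
     (\<forall>ds i x. (\<lambda>t. Dpar ds g (x + t *\<^sub>R axis i 1)) differentiable (at 0))"

definition schwartz :: "('n::finite) test \<Rightarrow> bool" where
  "schwartz \<phi> \<longleftrightarrow> smooth \<phi> \<and>
     (\<forall>ds (m::nat). \<exists>C. \<forall>x. (1 + norm x) ^ m * norm (Dpar ds \<phi> x) \<le> C)"

text \<open>Tempered distributions: linear functionals on the Schwartz space that are
  continuous, i.e. bounded by a Schwartz seminorm.\<close>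
definition tempered :: "('n::finite) distr \<Rightarrow> bool" where
  "tempered T \<longleftrightarrow>
     (\<forall>\<phi>1 \<phi>2. schwartz \<phi>1 \<longrightarrow> schwartz \<phi>2 \<longrightarrow> T (\<lambda>x. \<phi>1 x + \<phi>2 x) = T \<phi>1 + T \<phi>2) \<and>
     (\<forall>\<phi> (a::complex). schwartz \<phi> \<longrightarrow> T (\<lambda>x. a * \<phi> x) = a * T \<phi>) \<and>
     (\<exists>(N::nat) C. \<forall>\<phi> M. schwartz \<phi> \<longrightarrow>
        (\<forall>x ds. length ds \<le> N \<longrightarrow> (1 + norm x) ^ N * norm (Dpar ds \<phi> x) \<le> M) \<longrightarrow>
        norm (T \<phi>) \<le> C * M)"

definition fourier :: "('n::finite) test \<Rightarrow> 'n test" where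
  "fourier \<phi> \<xi> = (\<integral>x. \<phi> x * cis (- (x \<bullet> \<xi>)) \<partial>lborel)"

definition inv_fourier :: "('n::finite) test \<Rightarrow> 'n test" where
  "inv_fourier \<phi> x = complex_of_real ((2 * pi) powr (- real CARD('n))) *
                      (\<integral>\<xi>. \<phi> \<xi> * cis (x \<bullet> \<xi>) \<partial>lborel)"

definition fourier_d :: "('n::finite) distr \<Rightarrow> 'n distr" where
  "fourier_d T = (\<lambda>\<phi>. T (fourier \<phi>))"

definition inv_fourier_d :: "('n::finite) distr \<Rightarrow> 'n distr" where
  "inv_fourier_d T = (\<lambda>\<phi>. T (inv_fourier \<phi>))"

definition mult_d :: "(real^'n \<Rightarrow> real) \<Rightarrow> ('n::finite) distr \<Rightarrow> 'n distr" where
  "mult_d \<psi> T = (\<lambda>\<phi>. T (\<lambda>x. complex_of_real (\<psi> x) * \<phi> x))"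

definition represents :: "('n::finite) test \<Rightarrow> 'n distr \<Rightarrow> bool" where
  "represents g T \<longleftrightarrow> g \<in> borel_measurable lborel \<and>
     (\<forall>\<phi>. schwartz \<phi> \<longrightarrow> integrable lborel (\<lambda>x. g x * \<phi> x) \<and>
                         T \<phi> = (\<integral>x. g x * \<phi> x \<partial>lborel))"

definition epow :: "ennreal \<Rightarrow> real \<Rightarrow> ennreal" where
  "epow x r = (if x = top then (if r > 0 then top else if r = 0 then 1 else 0)
               else ennreal (enn2real x powr r))"

definition Lp_qnorm :: "ennreal \<Rightarrow> ('n::finite) test \<Rightarrow> ennreal" where
  "Lp_qnorm p g = (if p = top then esssup lborel (\<lambda>x. ennreal (norm (g x)))
     else epow (\<integral>\<^sup>+x. epow (ennreal (norm (g x))) (enn2real p) \<partial>lborel) (1 / enn2real p))"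

definition Lp_qnorm_d :: "ennreal \<Rightarrow> ('n::finite) distr \<Rightarrow> ennreal" where
  "Lp_qnorm_d p T = (if \<exists>g. represents g T then Lp_qnorm p (SOME g. represents g T) else top)"

definition lq_qnorm :: "ennreal \<Rightarrow> ('i \<Rightarrow> ennreal) \<Rightarrow> ennreal" where
  "lq_qnorm q a = (if q = top then (SUP i. a i)
     else epow (\<integral>\<^sup>+i. epow (a i) (enn2real q) \<partial>count_space UNIV) (1 / enn2real q))"

definition admissible_iso :: "(real^'n::finite \<Rightarrow> real) \<Rightarrow> bool" where
  "admissible_iso \<psi>0 \<longleftrightarrow> smooth (\<lambda>x. complex_of_real (\<psi>0 x)) \<and>
     (\<forall>x. (\<forall>i. \<bar>x $ i\<bar> \<le> 1) \<longrightarrow> \<psi>0 x = 1) \<and>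
     (\<forall>x. (\<exists>i. \<bar>x $ i\<bar> \<ge> 3/2) \<longrightarrow> \<psi>0 x = 0)"

definition psi :: "(real^'n::finite \<Rightarrow> real) \<Rightarrow> nat \<Rightarrow> real^'n \<Rightarrow> real" where
  "psi \<psi>0 j x = (if j = 0 then \<psi>0 x
                 else \<psi>0 ((2 powr (- real j)) *\<^sub>R x) - \<psi>0 ((2 powr (- real j + 1)) *\<^sub>R x))"

definition besov_qnorm :: "(real^'n::finite \<Rightarrow> real) \<Rightarrow> real \<Rightarrow> ennreal \<Rightarrow> ennreal \<Rightarrow> 'n distr \<Rightarrow> ennreal" where
  "besov_qnorm \<psi>0 s p q f = lq_qnorm q (\<lambda>j::nat. ennreal (2 powr (real j * s)) *
       Lp_qnorm_d p (inv_fourier_d (mult_d (psi \<psi>0 j) (fourier_d f))))"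

definition besov :: "(real^'n::finite \<Rightarrow> real) \<Rightarrow> real \<Rightarrow> ennreal \<Rightarrow> ennreal \<Rightarrow> 'n distr set" where
  "besov \<psi>0 s p q = {f. tempered f \<and> besov_qnorm \<psi>0 s p q f < top}"

definition smooth1 :: "(real \<Rightarrow> real) \<Rightarrow> bool" where
  "smooth1 \<phi> \<longleftrightarrow> (\<forall>k x. ((deriv ^^ k) \<phi>) differentiable (at x))"

definition admissible_1d :: "(real \<Rightarrow> real) \<Rightarrow> bool" where
  "admissible_1d \<phi>0 \<longleftrightarrow> smooth1 \<phi>0 \<and> (\<forall>s. \<bar>s\<bar> \<le> 1 \<longrightarrow> \<phi>0 s = 1) \<and>
     (\<forall>s. \<bar>s\<bar> > 3/2 \<longrightarrow> \<phi>0 s = 0)"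

definition phi1 :: "(real \<Rightarrow> real) \<Rightarrow> nat \<Rightarrow> real \<Rightarrow> real" where
  "phi1 \<phi>0 j s = (if j = 0 then \<phi>0 s
                  else \<phi>0 (2 powr (- real j) * s) - \<phi>0 (2 powr (- real j + 1) * s))"

definition phi_mixed :: "(real \<Rightarrow> real) \<Rightarrow> ('n::finite \<Rightarrow> nat) \<Rightarrow> real^'n \<Rightarrow> real" where
  "phi_mixed \<phi>0 k x = (\<Prod>i\<in>UNIV. phi1 \<phi>0 (k i) (x $ i))"

definition mixed_qnorm :: "(real \<Rightarrow> real) \<Rightarrow> real \<Rightarrow> ennreal \<Rightarrow> ennreal \<Rightarrow> ('n::finite) distr \<Rightarrow> ennreal" where
  "mixed_qnorm \<phi>0 t p q f = lq_qnorm q (\<lambda>k::'n \<Rightarrow> nat. ennreal (2 powr (real (\<Sum>i\<in>UNIV. k i) * t)) *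
       Lp_qnorm_d p (inv_fourier_d (mult_d (phi_mixed \<phi>0 k) (fourier_d f))))"

definition mixed_besov :: "(real \<Rightarrow> real) \<Rightarrow> real \<Rightarrow> ennreal \<Rightarrow> ennreal \<Rightarrow> ('n::finite) distr set" where
  "mixed_besov \<phi>0 t p q = {f. tempered f \<and> mixed_qnorm \<phi>0 t p q f < top}"

definition embeds :: "'a set \<Rightarrow> ('a \<Rightarrow> ennreal) \<Rightarrow> 'a set \<Rightarrow> ('a \<Rightarrow> ennreal) \<Rightarrow> bool" where
  "embeds X nX Y nY \<longleftrightarrow> X \<subseteq> Y \<and> (\<exists>C::real. C \<ge> 0 \<and> (\<forall>f\<in>X. nY f \<le> ennreal C * nX f))"

end

theory Submission
  imports Defs "HOL-Probability.Probability"
begin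

text \<open>
  Decompose \<open>f\<close> into its isotropic dyadic blocks \<open>f\<^sub>j\<close> and move the frequencies of each block into the
  corner of the frequency space by a modulation: \<open>g = \<Sum>j. exp (\<i> a\<^sub>j \<bullet> x) f\<^sub>j\<close> with \<open>a\<^sub>j = 14 * 2 ^ j (1, \<dots>, 1)\<close>.
  Then block \<open>j + 4\<close> of \<open>g\<close> in the isotropic decomposition and block \<open>(j + 4, \<dots>, j + 4)\<close> in the mixed
  one are both the modulated \<open>f\<^sub>j\<close>, and all other blocks of \<open>g\<close> vanish. Since modulation preserves every
  \<open>L\<^sub>p\<close> quasi-norm, the \<open>B\<close>-quasi-norm of \<open>g\<close> with parameters \<open>t0, p0, q0\<close> is a constant multiple of
  that of \<open>f\<close>, while the mixed quasi-norm of \<open>g\<close> with parameters \<open>t, p, q\<close> is a constant multiple of the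
  \<open>B\<close>-quasi-norm of \<open>f\<close> with smoothness \<open>t d\<close>. Applying the given embedding to \<open>g\<close> yields the claim.
  What has to be supplied is the convergence of the series in the tempered distributions, Fourier
  inversion for Schwartz functions, and the uniqueness of the function representing a distribution.
\<close>

text \<open>An unmodified block is of no use: the cube |xi_i| < 3/2 * 2^j in general meets mixed
  frequency boxes with many different |k|, so j does not determine the mixed weight 2^(|k| t).
  Modulation translates the frequencies and leaves the modulus of the block unchanged. After the
  translation only the diagonal index k = (j+4, ..., j+4) sees the block, and there |k| t = (j+4) t
  d; this is the source of the smoothness t d.

  The constants are forced up to scaling. A multiplier of index j+m is known to be 1 where every
  coordinate lies between 3/4 * 2^(j+m) and 2^(j+m). This interval has length 2^(j+m-2) and must
  contain a translate of an interval of length 3 * 2^j. So m = 4 is the smallest offset that leaves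
  room, and 14 is the midpoint of [12, 16].

  The series converges because the translated blocks are tested at frequencies of size about 2^j,
  where the inverse Fourier transform of a test function and its derivatives are rapidly decreasing,
  while the cutoffs have derivatives bounded uniformly in j. One spare power of the decay gives a
  factor 2^(-j) per block.\<close>

section \<open>Iterated partial derivatives and closure properties of smooth functions\<close>

text \<open>\<open>partial\<close> is built on a choice operator and has some value even where no
  derivative exists. The relation carries existence along with the value, so that sum, product and
  chain rules compose.\<close>

definition has_partial :: "'n::finite \<Rightarrow> 'n test \<Rightarrow> 'n test \<Rightarrow> bool" where
  "has_partial i g g' \<longleftrightarrow>
     (\<forall>x. ((\<lambda>t. g (x + t *\<^sub>R axis i 1)) has_vector_derivative g' x) (at 0))"

lemma has_partial_imp_partial: "has_partial i g g' \<Longrightarrow> partial i g = g'"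
  by (auto simp: has_partial_def partial_def fun_eq_iff vector_derivative_at)

lemma has_partial_line:
  assumes "has_partial i g g'"
  shows "((\<lambda>t. g (x + t *\<^sub>R axis i 1)) has_vector_derivative g' (x + t *\<^sub>R axis i 1)) (at t within S)"
proof -
  have "((\<lambda>s. g ((x + t *\<^sub>R axis i 1) + s *\<^sub>R axis i 1)) has_vector_derivative g' (x + t *\<^sub>R axis i 1)) (at 0)"
    using assms by (auto simp: has_partial_def)
  then have "((\<lambda>s. g ((x + t *\<^sub>R axis i 1) + s *\<^sub>R axis i 1)) \<circ> (\<lambda>s. s - t)
      has_vector_derivative 1 *\<^sub>R g' (x + t *\<^sub>R axis i 1)) (at t)"
    by (intro vector_diff_chain_at) (auto intro!: derivative_eq_intros)
  then have "((\<lambda>t. g (x + t *\<^sub>R axis i 1)) has_vector_derivative g' (x + t *\<^sub>R axis i 1)) (at t)"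
    by (simp add: o_def algebra_simps)
  then show ?thesis by (rule has_vector_derivative_at_within)
qed

text \<open>\<open>Dpar\<close> peels off the outermost derivative; here the innermost one is peeled
  off. Inductions that replace a function by its partial derivative use this form, so that mixed
  partials never have to be interchanged.\<close>

lemma Dpar_snoc: "Dpar (ds @ [i]) g = Dpar ds (partial i g)"
  by (induction ds) auto

lemma smooth_has_partial: "smooth g \<Longrightarrow> has_partial i g (partial i g)"
  by (auto simp: smooth_def has_partial_def partial_def vector_derivative_works[symmetric]
      dest!: spec[of _ "[]"])

lemma smooth_partial [intro]: "smooth g \<Longrightarrow> smooth (partial i g)"
  unfolding smooth_def by (metis Dpar_snoc)

lemma smooth_continuous_on: "smooth g \<Longrightarrow> continuous_on S g"
  unfolding smooth_def by (metis Dpar.simps(1) continuous_on_subset subset_UNIV)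

lemma smooth_Dpar: "smooth g \<Longrightarrow> smooth (Dpar ds g)"
  by (induction ds) auto

text \<open>A coinduction principle: iterated derivatives never leave a class that is closed under
  partial differentiation. Exhibiting such a class of continuous functions replaces explicit
  formulas for all derivatives.\<close>

lemma smooth_coinduct:
  assumes g: "P g"
    and cont: "\<And>g. P g \<Longrightarrow> continuous_on UNIV g"
    and step: "\<And>g i. P g \<Longrightarrow> \<exists>g'. P g' \<and> has_partial i g g'"
  shows "smooth g"
proof -
  have P: "P (Dpar ds g)" for ds
  proof (induction ds)
    case (Cons i ds)
    then show ?case using step[OF Cons, of i] by (auto dest: has_partial_imp_partial)
  qed (use g in simp)
  have "(\<lambda>t. Dpar ds g (x + t *\<^sub>R axis i 1)) differentiable (at 0)" for ds i x
    using step[OF P[of ds], of i] unfolding has_partial_def by (blast intro: differentiableI_vector)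
  with cont[OF P] show ?thesis by (auto simp: smooth_def)
qed

lemma has_partial_add:
  "has_partial i f f' \<Longrightarrow> has_partial i g g' \<Longrightarrow> has_partial i (\<lambda>x. f x + g x) (\<lambda>x. f' x + g' x)"
  unfolding has_partial_def by (auto intro: has_vector_derivative_add)

lemma has_partial_mult:
  "has_partial i f f' \<Longrightarrow> has_partial i g g' \<Longrightarrow>
    has_partial i (\<lambda>x. f x * g x) (\<lambda>x. f x * g' x + f' x * g x)"
  unfolding has_partial_def by (auto intro!: derivative_eq_intros)

lemma has_partial_const: "has_partial i (\<lambda>x. c) (\<lambda>x. 0)"
  unfolding has_partial_def by auto

lemma smooth_const: "smooth (\<lambda>x. c)"
  by (rule smooth_coinduct[where P="\<lambda>g. \<exists>c. g = (\<lambda>x. c)"]) (auto intro: has_partial_const)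

text \<open>The derivative of a product is a sum of products, so neither sums nor products of smooth
  functions alone form an invariant class. The generated algebra does, and coinduction collapses it
  to \<open>smooth\<close>.\<close>

inductive smooth_alg :: "('n::finite) test \<Rightarrow> bool" where
  base: "smooth g \<Longrightarrow> smooth_alg g"
| add: "smooth_alg f \<Longrightarrow> smooth_alg g \<Longrightarrow> smooth_alg (\<lambda>x. f x + g x)"
| mult: "smooth_alg f \<Longrightarrow> smooth_alg g \<Longrightarrow> smooth_alg (\<lambda>x. f x * g x)"

lemma smooth_alg_continuous: "smooth_alg g \<Longrightarrow> continuous_on UNIV g"
  by (induction rule: smooth_alg.induct) (auto intro: smooth_continuous_on continuous_intros)

lemma smooth_alg_has_partial:
  assumes "smooth_alg g"
  shows "\<exists>g'. smooth_alg g' \<and> has_partial i g g'"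
  using assms
proof (induction rule: smooth_alg.induct)
  case (base g)
  then show ?case using smooth_has_partial smooth_alg.base by blast
next
  case (add f g)
  then obtain f' g' where "smooth_alg f'" "has_partial i f f'" "smooth_alg g'" "has_partial i g g'"
    by blast
  then show ?case
    by (intro exI[of _ "\<lambda>x. f' x + g' x"] conjI smooth_alg.add has_partial_add)
next
  case (mult f g)
  then obtain f' g' where "smooth_alg f'" "has_partial i f f'" "smooth_alg g'" "has_partial i g g'"
    by blast
  with mult.hyps show ?case
    by (intro exI[of _ "\<lambda>x. f x * g' x + f' x * g x"] conjI smooth_alg.add smooth_alg.mult has_partial_mult)
qed

lemma smooth_alg_iff: "smooth_alg g \<longleftrightarrow> smooth g"
  using smooth_coinduct[where P=smooth_alg] smooth_alg_continuous smooth_alg_has_partial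
    smooth_alg.base by blast

lemma smooth_add: "smooth f \<Longrightarrow> smooth g \<Longrightarrow> smooth (\<lambda>x. f x + g x)"
  using smooth_alg.add smooth_alg_iff by blast

lemma smooth_mult: "smooth f \<Longrightarrow> smooth g \<Longrightarrow> smooth (\<lambda>x. f x * g x)"
  using smooth_alg.mult smooth_alg_iff by blast

lemma smooth_diff: "smooth f \<Longrightarrow> smooth g \<Longrightarrow> smooth (\<lambda>x. f x - g x)"
  using smooth_add[OF _ smooth_mult[OF smooth_const[of "-1"]], of f g] by simp

lemma smooth_prod:
  assumes "\<And>i. i \<in> A \<Longrightarrow> smooth (f i)"
  shows "smooth (\<lambda>x. \<Prod>i\<in>A. f i x)"
  using assms
  by (induction A rule: infinite_finite_induct) (auto intro: smooth_const smooth_mult)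

lemma Dpar_add:
  assumes "smooth f" "smooth g"
  shows "Dpar ds (\<lambda>x. f x + g x) = (\<lambda>x. Dpar ds f x + Dpar ds g x)"
proof (induction ds)
  case (Cons i ds)
  then show ?case
    using has_partial_imp_partial[OF has_partial_add[OF
        smooth_has_partial[OF smooth_Dpar[OF assms(1), of ds], of i]
        smooth_has_partial[OF smooth_Dpar[OF assms(2), of ds], of i]]]
    by simp
qed simp

lemma has_partial_cmult: "has_partial i f f' \<Longrightarrow> has_partial i (\<lambda>x. c * f x) (\<lambda>x. c * f' x)"
  using has_partial_mult[OF has_partial_const[of i c], of f f'] by simp

lemma Dpar_cmult:
  assumes "smooth f"
  shows "Dpar ds (\<lambda>x. c * f x) = (\<lambda>x. c * Dpar ds f x)"
proof (induction ds)
  case (Cons i ds)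
  then show ?case
    using has_partial_imp_partial[OF has_partial_cmult[OF
        smooth_has_partial[OF smooth_Dpar[OF assms(1), of ds], of i], of c]]
    by simp
qed simp

lemma has_partial_affine:
  assumes "has_partial i g g'"
  shows "has_partial i (\<lambda>x. g (c *\<^sub>R x + a)) (\<lambda>x. of_real c * g' (c *\<^sub>R x + a))"
proof -
  have "((\<lambda>t. g (c *\<^sub>R (x + t *\<^sub>R axis i 1) + a)) has_vector_derivative of_real c * g' (c *\<^sub>R x + a)) (at 0)" for x
  proof -
    have "((\<lambda>t. g ((c *\<^sub>R x + a) + t *\<^sub>R axis i 1)) \<circ> (\<lambda>t. c * t) has_vector_derivative
        c *\<^sub>R g' (c *\<^sub>R x + a)) (at 0)"
      using assms by (intro vector_diff_chain_at)
        (auto simp: has_partial_def intro!: derivative_eq_intros)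
    then show ?thesis
      by (simp add: o_def algebra_simps scaleR_conv_of_real)
  qed
  then show ?thesis unfolding has_partial_def by blast
qed

lemma Dpar_affine:
  assumes "smooth g"
  shows "Dpar ds (\<lambda>x. g (c *\<^sub>R x + a)) = (\<lambda>x. of_real c ^ length ds * Dpar ds g (c *\<^sub>R x + a))"
proof (induction ds)
  case (Cons i ds)
  then show ?case
    using has_partial_imp_partial[OF has_partial_cmult[OF has_partial_affine[OF
        smooth_has_partial[OF smooth_Dpar[OF assms(1), of ds], of i], of c a], of "of_real c ^ length ds"]]
    by (simp add: mult_ac)
qed simp

lemma smooth_affine:
  assumes "smooth g"
  shows "smooth (\<lambda>x. g (c *\<^sub>R x + a))"
\<comment> \<open>Each differentiation pulls out another factor \<open>c\<close>; the coefficient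
  \<open>k\<close> in the invariant absorbs these factors.\<close>
proof (rule smooth_coinduct[where P="\<lambda>f. \<exists>g k. smooth g \<and> f = (\<lambda>x. of_real k * g (c *\<^sub>R x + a))"])
  show "\<exists>ga k. smooth ga \<and> (\<lambda>x. g (c *\<^sub>R x + a)) = (\<lambda>x. of_real k * ga (c *\<^sub>R x + a))"
    using assms by (intro exI[of _ g] exI[of _ 1]) auto
next
  fix f :: "'a test" assume "\<exists>g k. smooth g \<and> f = (\<lambda>x. of_real k * g (c *\<^sub>R x + a))"
  then obtain g k where g: "smooth g" and f: "f = (\<lambda>x. of_real k * g (c *\<^sub>R x + a))" by blast
  show "continuous_on UNIV f"
    unfolding f by (intro continuous_intros continuous_on_compose2[OF smooth_continuous_on[OF g, of UNIV]]) auto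
  fix i
  have "has_partial i f (\<lambda>x. of_real k * (of_real c * partial i g (c *\<^sub>R x + a)))"
    unfolding f by (intro has_partial_cmult has_partial_affine smooth_has_partial g)
  then show "\<exists>g'. (\<exists>g k. smooth g \<and> g' = (\<lambda>x. of_real k * g (c *\<^sub>R x + a))) \<and> has_partial i f g'"
    using smooth_partial[OF g, of i]
    by (intro exI[of _ "\<lambda>x. of_real (k * c) * partial i g (c *\<^sub>R x + a)"] conjI
        exI[of _ "partial i g"] exI[of _ "k * c"]) (simp_all add: mult.assoc)
qed

text \<open>By the product rule each derivative at most doubles the number of terms, hence the power
  of 2. Induction from the right differentiates innermost first, so the bounds required for
  \<open>partial i f\<close> and \<open>partial i g\<close> are instances of the given ones.\<close>

lemma Dpar_mult_bound:
  assumes "smooth f" "smooth g" "0 \<le> A" "0 \<le> B"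
    and "\<And>es. length es \<le> length ds \<Longrightarrow> norm (Dpar es f x) \<le> A"
    and "\<And>es. length es \<le> length ds \<Longrightarrow> norm (Dpar es g x) \<le> B"
  shows "norm (Dpar ds (\<lambda>x. f x * g x) x) \<le> 2 ^ length ds * A * B"
  using assms
proof (induction ds arbitrary: f g rule: rev_induct)
  case Nil
  then show ?case using mult_mono[of "norm (f x)" A "norm (g x)" B] Nil(5,6)[of "[]"] by (auto simp: norm_mult)
next
  case (snoc i ds)
  have *: "partial i (\<lambda>x. f x * g x) = (\<lambda>x. f x * partial i g x + partial i f x * g x)"
    using snoc by (intro has_partial_imp_partial has_partial_mult smooth_has_partial)
  have fb: "norm (Dpar es (partial i f) x) \<le> A" and gb: "norm (Dpar es (partial i g) x) \<le> B"
    if "length es \<le> length ds" for es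
    using snoc.prems(5,6)[of "es @ [i]"] that by (auto simp: Dpar_snoc)
  have "norm (Dpar ds (\<lambda>x. f x * partial i g x) x) \<le> 2 ^ length ds * A * B"
    using snoc.prems by (intro snoc.IH smooth_partial gb) auto
  moreover have "norm (Dpar ds (\<lambda>x. partial i f x * g x) x) \<le> 2 ^ length ds * A * B"
    using snoc.prems by (intro snoc.IH smooth_partial fb) auto
  ultimately show ?case
    using snoc.prems(1,2)
    by (auto simp: Dpar_snoc * Dpar_add smooth_mult smooth_partial intro: order.trans[OF norm_triangle_ineq])
qed

lemma Dpar_zero_on_open:
  assumes "open U" "\<And>x. x \<in> U \<Longrightarrow> g x = 0" "x \<in> U"
  shows "Dpar ds g x = 0"
  using assms(3)
proof (induction ds arbitrary: x)
  case (Cons i ds)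
  have "((\<lambda>t. x + t *\<^sub>R axis i 1) \<longlongrightarrow> x) (at 0)"
    by (auto intro!: tendsto_eq_intros)
  then have "\<forall>\<^sub>F t in at 0. x + t *\<^sub>R axis i 1 \<in> U"
    using assms(1) Cons.prems by (simp add: topological_tendstoD)
  then have "\<forall>\<^sub>F t in nhds 0. x + t *\<^sub>R axis i 1 \<in> U"
    using Cons.prems by (simp add: eventually_nhds_conv_at)
  then have "\<forall>\<^sub>F t in nhds 0. Dpar ds g (x + t *\<^sub>R axis i 1) = 0"
    by eventually_elim (use Cons.IH in blast)
  then have "((\<lambda>t. Dpar ds g (x + t *\<^sub>R axis i 1)) has_vector_derivative 0) (at 0)"
    by (subst has_vector_derivative_cong_ev[where g="\<lambda>_. 0"]) (auto dest: eventually_nhds_x_imp_x)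
  then show ?case by (simp add: partial_def vector_derivative_at)
qed (use assms in auto)

section \<open>Schwartz seminorms and multipliers\<close>

text \<open>This is the premise in the continuity clause of \<open>tempered\<close>, with one index
  for both the weight and the number of derivatives. As a relation to an upper bound it avoids
  suprema and their existence.\<close>

definition semi :: "nat \<Rightarrow> ('n::finite) test \<Rightarrow> real \<Rightarrow> bool" where
  "semi N \<phi> M \<longleftrightarrow> (\<forall>x ds. length ds \<le> N \<longrightarrow> (1 + norm x) ^ N * norm (Dpar ds \<phi> x) \<le> M)"

lemma semi_bound: "semi N \<phi> M \<Longrightarrow> (1 + norm x) ^ N * norm (\<phi> x) \<le> M"
  unfolding semi_def by (metis Dpar.simps(1) le0 list.size(3))

lemma semi_nonneg: "semi N \<phi> M \<Longrightarrow> 0 \<le> M"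
  using semi_bound[of N \<phi> M 0] order.trans[OF norm_ge_zero[of "\<phi> 0"]] by auto

lemma semi_antimono:
  assumes "semi N' \<phi> M" "N \<le> N'"
  shows "semi N \<phi> M"
  unfolding semi_def
proof (intro allI impI)
  fix x :: "real^'a" and ds :: "'a list" assume "length ds \<le> N"
  then have "(1 + norm x) ^ N' * norm (Dpar ds \<phi> x) \<le> M"
    using assms by (auto simp: semi_def)
  moreover have "(1 + norm x) ^ N \<le> (1 + norm x) ^ N'"
    using assms by (intro power_increasing) auto
  ultimately show "(1 + norm x) ^ N * norm (Dpar ds \<phi> x) \<le> M"
    by (meson mult_right_mono norm_ge_zero order.trans)
qed

lemma semi_partial:
  assumes "semi (Suc N) \<phi> M"
  shows "semi N (partial i \<phi>) M"
  unfolding semi_def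
proof (intro allI impI)
  fix x :: "real^'a" and ds :: "'a list" assume "length ds \<le> N"
  then have "(1 + norm x) ^ Suc N * norm (Dpar (ds @ [i]) \<phi> x) \<le> M"
    using assms unfolding semi_def by (metis Suc_le_mono length_append_singleton)
  moreover have "(1 + norm x) ^ N \<le> (1 + norm x) ^ Suc N"
    by (intro power_increasing) auto
  ultimately show "(1 + norm x) ^ N * norm (Dpar ds (partial i \<phi>) x) \<le> M"
    by (metis Dpar_snoc mult_right_mono norm_ge_zero order.trans)
qed

lemma finite_bounded_lists: "finite {ds :: ('n::finite) list. length ds \<le> N}"
  using finite_lists_length_le[of "UNIV :: 'n set" N] by simp

text \<open>The definition of \<open>schwartz\<close> has one constant per list of directions,
  \<open>semi\<close> a common one. There are only finitely many lists of bounded length, so the sum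
  of their constants serves for all.\<close>

lemma schwartz_iff_semi: "schwartz \<phi> \<longleftrightarrow> smooth \<phi> \<and> (\<forall>N. \<exists>M. semi N \<phi> M)"
proof safe
  assume *: "schwartz \<phi>"
  show "smooth \<phi>" using * by (simp add: schwartz_def)
  fix N
  from * obtain C where C: "\<And>ds x. (1 + norm x) ^ N * norm (Dpar ds \<phi> x) \<le> C ds"
    unfolding schwartz_def by meson
  have "C ds \<le> (\<Sum>ds\<in>{ds. length ds \<le> N}. \<bar>C ds\<bar>)" if "length ds \<le> N" for ds
    using member_le_sum[of ds "{ds. length ds \<le> N}" "\<lambda>ds. \<bar>C ds\<bar>"] that finite_bounded_lists by fastforce
  then show "\<exists>M. semi N \<phi> M" unfolding semi_def using C by (meson order.trans)
next
  assume "smooth \<phi>" and *: "\<forall>N. \<exists>M. semi N \<phi> M"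
  have "\<exists>C. \<forall>x. (1 + norm x) ^ m * norm (Dpar ds \<phi> x) \<le> C" for ds m
  proof -
    obtain M where M: "semi (max m (length ds)) \<phi> M" using * by blast
    have "(1 + norm x) ^ m * norm (Dpar ds \<phi> x) \<le> M" for x
    proof -
      have "(1 + norm x) ^ m \<le> (1 + norm x) ^ max m (length ds)"
        by (intro power_increasing) auto
      then have "(1 + norm x) ^ m * norm (Dpar ds \<phi> x) \<le> (1 + norm x) ^ max m (length ds) * norm (Dpar ds \<phi> x)"
        by (intro mult_right_mono) auto
      also have "\<dots> \<le> M" using M by (auto simp: semi_def)
      finally show ?thesis .
    qed
    then show ?thesis by blast
  qed
  with \<open>smooth \<phi>\<close> show "schwartz \<phi>" by (auto simp: schwartz_def)
qed

lemma schwartz_smooth: "schwartz \<phi> \<Longrightarrow> smooth \<phi>"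
  by (simp add: schwartz_def)

lemma schwartz_partial: "schwartz \<phi> \<Longrightarrow> schwartz (partial i \<phi>)"
  unfolding schwartz_iff_semi using semi_partial by blast

text \<open>Polynomial growth of degree \<open>k\<close> of the multiplier is paid for with
  \<open>k\<close> additional powers of the weight on \<phi>.\<close>

lemma semi_mult:
  assumes "smooth m" "smooth \<phi>" "0 \<le> A"
    and m: "\<And>es x. length es \<le> N \<Longrightarrow> norm (Dpar es m x) \<le> A * (1 + norm x) ^ k"
    and \<phi>: "semi (N + k) \<phi> M"
  shows "semi N (\<lambda>x. m x * \<phi> x) (2 ^ N * A * M)"
  unfolding semi_def
proof (intro allI impI)
  fix x :: "real^'a" and ds :: "'a list" assume ds: "length ds \<le> N"
  have pos: "0 < 1 + norm x" by (simp add: add_pos_nonneg)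
  have M0: "0 \<le> M" using semi_nonneg \<phi> by blast
  have "norm (Dpar ds (\<lambda>x. m x * \<phi> x) x) \<le> 2 ^ length ds * (A * (1 + norm x) ^ k) * (M / (1 + norm x) ^ (N + k))"
    using assms pos ds M0
    by (intro Dpar_mult_bound) (auto simp: semi_def field_simps)
  then have "(1 + norm x) ^ N * norm (Dpar ds (\<lambda>x. m x * \<phi> x) x) \<le>
     (1 + norm x) ^ N * (2 ^ length ds * (A * (1 + norm x) ^ k) * (M / (1 + norm x) ^ (N + k)))"
    using pos by (intro mult_left_mono) auto
  also have "\<dots> = 2 ^ length ds * A * M"
    using pos by (simp add: power_add)
  also have "\<dots> \<le> 2 ^ N * A * M"
    using ds M0 assms by (intro mult_right_mono power_increasing) auto
  finally show "(1 + norm x) ^ N * norm (Dpar ds (\<lambda>x. m x * \<phi> x) x) \<le> 2 ^ N * A * M" .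
qed

lemma schwartz_mult:
  assumes "smooth m" "schwartz \<phi>"
    and "\<And>N. \<exists>A k. \<forall>es x. length es \<le> N \<longrightarrow> norm (Dpar es m x) \<le> A * (1 + norm x) ^ k"
  shows "schwartz (\<lambda>x. m x * \<phi> x)"
  unfolding schwartz_iff_semi
proof safe
  show "smooth (\<lambda>x. m x * \<phi> x)" using assms smooth_mult schwartz_smooth by blast
  fix N
  obtain A k where Ak: "\<And>es x. length es \<le> N \<Longrightarrow> norm (Dpar es m x) \<le> A * (1 + norm x) ^ k"
    using assms(3)[of N] by blast
  have "0 \<le> A" using order.trans[OF norm_ge_zero Ak[of "[]" 0]] by simp
  moreover obtain M where "semi (N + k) \<phi> M" using assms schwartz_iff_semi by blast
  ultimately show "\<exists>M. semi N (\<lambda>x. m x * \<phi> x) M"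
    using semi_mult[OF assms(1) schwartz_smooth[OF assms(2)] _ Ak] by blast
qed

lemma schwartz_cmult:
  fixes \<phi> :: "('n::finite) test"
  shows "schwartz \<phi> \<Longrightarrow> schwartz (\<lambda>x. c * \<phi> x)"
proof (rule schwartz_mult[OF smooth_const])
  fix N
  have "Dpar es (\<lambda>x::real^'n. c) = (if es = [] then (\<lambda>x. c) else (\<lambda>x. 0))" for es :: "'n list"
    by (induction es) (auto simp: has_partial_imp_partial[OF has_partial_const])
  then show "\<exists>A k. \<forall>es x. length es \<le> N \<longrightarrow> norm (Dpar es (\<lambda>x::real^'n. c) x) \<le> A * (1 + norm x) ^ k"
    by (intro exI[of _ "norm c"] exI[of _ 0]) auto
qed

text \<open>All derivatives vanish on the open exterior of the ball and are continuous on the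
  compact closed ball; finitely many lists make the bound uniform.\<close>

lemma compact_support_Dpar_bound:
  assumes "smooth g" "\<And>x. norm x > R \<Longrightarrow> g x = 0"
  shows "\<exists>A\<ge>0. \<forall>es x. length es \<le> N \<longrightarrow> norm (Dpar es g x) \<le> A"
proof -
  have "\<exists>A. \<forall>x. norm (Dpar es g x) \<le> A" for es
  proof -
    have "compact (Dpar es g ` cball 0 R)"
      using assms(1) by (intro compact_continuous_image smooth_continuous_on smooth_Dpar) auto
    then obtain B where "\<forall>x\<in>cball 0 R. norm (Dpar es g x) \<le> B"
      by (auto dest!: compact_imp_bounded simp: bounded_iff)
    then have B: "norm (Dpar es g x) \<le> B" if "norm x \<le> R" for x
      using that by simp
    have "open {x :: real^'a. norm x > R}"
      by (intro open_Collect_less continuous_intros)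
    then have "Dpar es g x = 0" if "norm x > R" for x
      using Dpar_zero_on_open[of "{x. norm x > R}" g x] assms that by auto
    then have "norm (Dpar es g x) \<le> max B 0" for x
      using B[of x] by (cases "norm x \<le> R") auto
    then show ?thesis by blast
  qed
  then obtain A where A: "\<And>es x. norm (Dpar es g x) \<le> A es" by metis
  have "A ds \<le> (\<Sum>ds\<in>{ds. length ds \<le> N}. \<bar>A ds\<bar>)" if "length ds \<le> N" for ds
    using member_le_sum[of ds "{ds. length ds \<le> N}" "\<lambda>ds. \<bar>A ds\<bar>"] that finite_bounded_lists by fastforce
  then show ?thesis using A
    by (intro exI[of _ "(\<Sum>ds\<in>{ds. length ds \<le> N}. \<bar>A ds\<bar>)"]) (auto intro: order.trans sum_nonneg)
qed

lemma schwartz_compact_support: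
  assumes "smooth g" "\<And>x. norm x > R \<Longrightarrow> g x = 0"
  shows "schwartz g"
  unfolding schwartz_iff_semi
proof safe
  fix N
  obtain A where A: "A \<ge> 0" "\<And>es x. length es \<le> N \<Longrightarrow> norm (Dpar es g x) \<le> A"
    using compact_support_Dpar_bound[OF assms] by metis
  have "open {x :: real^'a. norm x > R}"
    by (intro open_Collect_less continuous_intros)
  then have z: "Dpar es g x = 0" if "norm x > R" for x es
    using Dpar_zero_on_open[of "{x. norm x > R}" g x] assms that by auto
  have "semi N g ((1 + \<bar>R\<bar>) ^ N * A)"
    unfolding semi_def
  proof (intro allI impI)
    fix x :: "real^'a" and ds :: "'a list" assume "length ds \<le> N"
    then show "(1 + norm x) ^ N * norm (Dpar ds g x) \<le> (1 + \<bar>R\<bar>) ^ N * A"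
      using A z[of x ds] by (cases "norm x > R") (auto intro!: mult_mono power_mono)
  qed
  then show "\<exists>M. semi N g M" by blast
qed (use assms in auto)

lemma schwartz_bounded_mult:
  assumes "smooth m" "\<And>x. norm x > R \<Longrightarrow> m x = 0" "schwartz \<phi>"
  shows "schwartz (\<lambda>x. m x * \<phi> x)"
proof (rule schwartz_mult)
  fix N
  show "\<exists>A k. \<forall>es x. length es \<le> N \<longrightarrow> norm (Dpar es m x) \<le> A * (1 + norm x) ^ k"
    using compact_support_Dpar_bound[OF assms(1,2), where N=N] mult.right_neutral power_0
    by (metis (no_types, lifting))
qed (use assms in auto)

section \<open>Integrability against polynomial weights and translation invariance\<close>

lemma norm_integral_le_integral:
  fixes f :: "'a \<Rightarrow> 'b::{banach, second_countable_topology}"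
  assumes "integrable M f" "integrable M g" "\<And>x. norm (f x) \<le> g x"
  shows "norm (integral\<^sup>L M f) \<le> integral\<^sup>L M g"
  using assms by (intro order.trans[OF integral_norm_bound] integral_mono) auto

lemma nn_integral_inverse_1_plus_square: "(\<integral>\<^sup>+x. ennreal (inverse (1 + x\<^sup>2)) \<partial>lborel) < \<infinity>"
proof -
  have "integrable lborel (\<lambda>x::real. inverse (1 + x\<^sup>2))"
    using integrable_inverse_1_plus_square
    by (simp add: set_integrable_def einterval_def)
  then show ?thesis
    by (simp add: integrable_iff_bounded)
qed

text \<open>Explains the exponent \<open>2 * CARD('n)\<close> used throughout: with it the
  reciprocal weight is dominated by a product of one-dimensional functions 1/(1+s^2), each of finite
  integral.\<close>

lemma norm_Pow_ge_prod_coord: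
  fixes x :: "real^'n::finite"
  shows "(\<Prod>b\<in>Basis. 1 + (x \<bullet> b)\<^sup>2) \<le> (1 + norm x) ^ (2 * CARD('n))"
proof -
  have "(\<Prod>b\<in>Basis. 1 + (x \<bullet> b)\<^sup>2) \<le> (\<Prod>b\<in>(Basis :: (real^'n) set). (1 + norm x)\<^sup>2)"
  proof (rule prod_mono, safe)
    fix b :: "real^'n" assume "b \<in> Basis"
    then have "(x \<bullet> b)\<^sup>2 \<le> (norm x)\<^sup>2"
      by (metis Basis_le_norm abs_norm_cancel abs_le_square_iff)
    then show "1 + (x \<bullet> b)\<^sup>2 \<le> (1 + norm x)\<^sup>2" using add_increasing2[of "2 * norm x" "(x \<bullet> b)\<^sup>2" "(norm x)\<^sup>2"] by (simp add: power2_sum)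
  qed simp
  then show ?thesis by (simp add: power_mult)
qed

abbreviation weight :: "real^'n::finite \<Rightarrow> real" where
  "weight x \<equiv> 1 / (1 + norm x) ^ (2 * CARD('n))"

lemma integrable_weight: "integrable lborel (weight :: real^'n::finite \<Rightarrow> real)"
proof (rule integrableI_bounded)
  have "(\<integral>\<^sup>+x. ennreal (norm (weight x)) \<partial>(lborel :: (real^'n) measure)) \<le>
      (\<integral>\<^sup>+x. (\<Prod>b\<in>(Basis :: (real^'n) set). ennreal (inverse (1 + (x \<bullet> b)\<^sup>2))) \<partial>lborel)"
  proof (rule nn_integral_mono)
    fix x :: "real^'n"
    have "0 < (\<Prod>b\<in>Basis. 1 + (x \<bullet> b)\<^sup>2)"
      by (intro prod_pos) (auto simp: add_pos_nonneg)
    then have "weight x \<le> inverse (\<Prod>b\<in>Basis. 1 + (x \<bullet> b)\<^sup>2)"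
      using norm_Pow_ge_prod_coord[of x] by (simp add: field_simps inverse_eq_divide frac_le)
    then show "ennreal (norm (weight x)) \<le> (\<Prod>b\<in>Basis. ennreal (inverse (1 + (x \<bullet> b)\<^sup>2)))"
      using prod_inversef[of "\<lambda>b. 1 + (x \<bullet> b)\<^sup>2" Basis]
      by (simp add: prod_ennreal o_def ennreal_leI)
  qed
  also have "\<dots> = (\<Prod>b\<in>(Basis :: (real^'n) set). \<integral>\<^sup>+x. ennreal (inverse (1 + x\<^sup>2)) \<partial>lborel)"
    by (rule nn_integral_lborel_prod) auto
  also have "\<dots> < \<infinity>"
    using nn_integral_inverse_1_plus_square by (simp add: power_less_top_ennreal)
  finally show "(\<integral>\<^sup>+x. ennreal (norm (weight x :: real)) \<partial>(lborel :: (real^'n) measure)) < \<infinity>" .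
qed measurable

lemma weighted_integrable:
  fixes \<phi> :: "('n::finite) test"
  assumes "\<phi> \<in> borel_measurable borel" "\<And>x. (1 + norm x) ^ (2 * CARD('n)) * norm (\<phi> x) \<le> M"
  shows "integrable lborel \<phi>"
    and "norm (integral\<^sup>L lborel \<phi>) \<le> M * (\<integral>x. weight (x :: real^'n) \<partial>lborel)"
proof -
  have i: "integrable lborel (\<lambda>x::real^'n. M * weight x)"
    using integrable_weight by (intro integrable_mult_right)
  have b: "norm (\<phi> x) \<le> M * weight x" for x
  proof -
    have "0 < (1 + norm x) ^ (2 * CARD('n))" by (simp add: add_pos_nonneg)
    with assms(2)[of x] show ?thesis by (simp add: field_simps)
  qed
  show 1: "integrable lborel \<phi>"
    by (rule Bochner_Integration.integrable_bound[OF i]) (use assms(1) order.trans[OF b abs_ge_self] in auto)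
  have "norm (integral\<^sup>L lborel \<phi>) \<le> (\<integral>x. M * weight (x :: real^'n) \<partial>lborel)"
    by (rule norm_integral_le_integral[OF 1 i b])
  then show "norm (integral\<^sup>L lborel \<phi>) \<le> M * (\<integral>x. weight (x :: real^'n) \<partial>lborel)"
    by (simp only: integral_mult_right_zero)
qed

lemma schwartz_measurable [measurable]: "schwartz \<phi> \<Longrightarrow> \<phi> \<in> borel_measurable borel"
  by (intro borel_measurable_continuous_onI smooth_continuous_on schwartz_smooth)

lemma schwartz_integrable:
  fixes \<phi> :: "('n::finite) test"
  assumes "schwartz \<phi>"
  shows "integrable lborel \<phi>"
proof -
  obtain M where "semi (2 * CARD('n)) \<phi> M" using assms schwartz_iff_semi by blast
  then show ?thesis using assms semi_bound by (intro weighted_integrable(1)) (auto simp: schwartz_measurable)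
qed

lemma integral_translate:
  fixes g :: "'a::euclidean_space \<Rightarrow> 'b::{banach, second_countable_topology}"
  assumes "g \<in> borel_measurable borel"
  shows "(\<integral>x. g (x + c) \<partial>lborel) = (\<integral>x. g x \<partial>lborel)"
proof -
  have "(\<integral>x. g x \<partial>lborel) = (\<integral>x. g x \<partial>distr lborel borel ((+) c))"
    by (simp add: lborel_distr_plus)
  also have "\<dots> = (\<integral>x. g (c + x) \<partial>lborel)"
    using assms by (intro integral_distr) auto
  finally show ?thesis by (simp add: add.commute)
qed

lemma integrable_translate:
  fixes g :: "'a::euclidean_space \<Rightarrow> 'b::{banach, second_countable_topology}"
  assumes "integrable lborel g"
  shows "integrable lborel (\<lambda>x. g (x + c))"
proof -
  have "integrable (distr lborel borel ((+) c)) g"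
    using assms by (simp add: lborel_distr_plus)
  then show ?thesis using assms
    by (subst (asm) integrable_distr_eq) (auto simp: add.commute)
qed

text \<open>Moving the base point by at most 1 costs at most a factor 2 per power of the weight.
  This yields a majorant for difference quotients that is independent of the step size.\<close>

lemma weight_shift:
  fixes x y :: "real^'n::finite"
  assumes "norm (y - x) \<le> 1" "0 \<le> M" "(1 + norm y) ^ k * a \<le> M" "0 \<le> a"
  shows "(1 + norm x) ^ k * a \<le> 2 ^ k * M"
proof -
  have "norm x \<le> norm y + 1"
    using assms(1) norm_triangle_sub[of x y] by (simp add: norm_minus_commute)
  then have "1 + norm x \<le> 2 * (1 + norm y)" by (simp add: algebra_simps) (use norm_ge_zero[of y] in linarith)
  then have "(1 + norm x) ^ k \<le> (2 * (1 + norm y)) ^ k"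
    by (intro power_mono) auto
  then have "(1 + norm x) ^ k * a \<le> 2 ^ k * ((1 + norm y) ^ k * a)"
    using assms(4) mult_right_mono[of _ _ a] by (simp only: power_mult_distrib mult.assoc[symmetric])
  also have "\<dots> \<le> 2 ^ k * M" using assms by (intro mult_left_mono) auto
  finally show ?thesis .
qed

lemma increment_bound:
  assumes "has_partial i g g'" "\<And>s. 0 \<le> s \<Longrightarrow> s \<le> t \<Longrightarrow> norm (g' (x + s *\<^sub>R axis i 1)) \<le> B" "0 \<le> t"
  shows "norm (g (x + t *\<^sub>R axis i 1) - g x) \<le> B * t"
proof -
  have "norm ((\<lambda>s. g (x + s *\<^sub>R axis i 1)) t - (\<lambda>s. g (x + s *\<^sub>R axis i 1)) 0) \<le> B * norm (t - 0)"
  proof (rule differentiable_bound[of "{0..t}" _ "\<lambda>s h. h *\<^sub>R g' (x + s *\<^sub>R axis i 1)"])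
    fix s assume s: "s \<in> {0..t}"
    show "((\<lambda>s. g (x + s *\<^sub>R axis i 1)) has_derivative (\<lambda>h. h *\<^sub>R g' (x + s *\<^sub>R axis i 1))) (at s within {0..t})"
      using has_partial_line[OF assms(1)] by (simp add: has_vector_derivative_def)
    show "onorm (\<lambda>h. h *\<^sub>R g' (x + s *\<^sub>R axis i 1)) \<le> B"
      using assms(2)[of s] s by (simp add: onorm_scaleR_left onorm_id)
  qed (use assms in auto)
  then show ?thesis using assms by simp
qed

lemma has_vector_derivative_quotient:
  assumes "(f has_vector_derivative D) (at 0)"
  shows "((\<lambda>h. (f h - f 0) /\<^sub>R h) \<longlongrightarrow> D) (at 0)"
proof -
  have "((\<lambda>h. norm (f h - f 0 - h *\<^sub>R D) / norm h) \<longlongrightarrow> 0) (at 0)"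
    using assms by (simp add: has_vector_derivative_def has_derivative_at)
  moreover have "\<forall>\<^sub>F h in at 0. norm (f h - f 0 - h *\<^sub>R D) / norm h = norm ((f h - f 0) /\<^sub>R h - D)"
    unfolding eventually_at_filter
  proof (intro always_eventually allI impI)
    fix h :: real assume "h \<noteq> 0"
    then have "(f h - f 0) /\<^sub>R h - D = (f h - f 0 - h *\<^sub>R D) /\<^sub>R h" by (simp add: scaleR_diff_right)
    then show "norm (f h - f 0 - h *\<^sub>R D) / norm h = norm ((f h - f 0) /\<^sub>R h - D)"
      by (simp add: divide_inverse mult.commute)
  qed
  ultimately have "((\<lambda>h. norm ((f h - f 0) /\<^sub>R h - D)) \<longlongrightarrow> 0) (at 0)"
    by (rule Lim_transform_eventually)
  then show ?thesis using Lim_null tendsto_norm_zero_iff by blast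
qed

text \<open>Difference quotients have integral zero by translation invariance, and dominated
  convergence passes to the derivative. Steps \<open>t n\<close> of size at most 1 keep all
  intermediate points within reach of \<open>weight_shift\<close>.\<close>

lemma integral_partial_zero:
  fixes g :: "('n::finite) test"
  assumes "schwartz g"
  shows "(\<integral>x. partial i g x \<partial>lborel) = 0"
proof -
  define k where "k = 2 * CARD('n)"
  define t :: "nat \<Rightarrow> real" where "t n = inverse (real (Suc n))" for n
  have t0: "t \<longlonglongrightarrow> 0" unfolding t_def by (rule LIMSEQ_inverse_real_of_nat)
  have tp: "0 < t n" "t n \<le> 1" for n by (auto simp: t_def field_simps)
  define s where "s n x = (g (x + t n *\<^sub>R axis i 1) - g x) /\<^sub>R t n" for n x
  have gp: "has_partial i g (partial i g)" using assms schwartz_smooth smooth_has_partial by blast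
  have gm [measurable]: "g \<in> borel_measurable borel" using assms by measurable
  have gm' [measurable]: "partial i g \<in> borel_measurable borel" using schwartz_partial[OF assms] by measurable
  have sm: "s n \<in> borel_measurable borel" for n unfolding s_def[abs_def] by measurable
  have gi: "integrable lborel g" using assms by (rule schwartz_integrable)
  have "semi k (partial i g) M \<Longrightarrow> 0 \<le> M" for M by (rule semi_nonneg)
  then obtain M where M: "semi k (partial i g) M" "0 \<le> M"
    using schwartz_partial[OF assms] schwartz_iff_semi by blast
  have "(\<lambda>n. integral\<^sup>L lborel (s n)) \<longlonglongrightarrow> (\<integral>x. partial i g x \<partial>lborel)"
  proof (rule integral_dominated_convergence[where w="\<lambda>x. (2 ^ k * M) * weight x"])
    show "integrable lborel (\<lambda>x::real^'n. (2 ^ k * M) * weight x)"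
      using integrable_weight by (intro integrable_mult_right)
    show "AE x in lborel. (\<lambda>n. s n x) \<longlonglongrightarrow> partial i g x"
    proof (rule AE_I2)
      fix x
      have "((\<lambda>h. (g (x + h *\<^sub>R axis i 1) - g x) /\<^sub>R h) \<longlongrightarrow> partial i g x) (at 0)"
        using gp has_vector_derivative_quotient[of "\<lambda>t. g (x + t *\<^sub>R axis i 1)"] by (simp add: has_partial_def)
      then show "(\<lambda>n. s n x) \<longlonglongrightarrow> partial i g x"
        unfolding s_def by (rule filterlim_compose) (use t0 tp in \<open>auto simp: filterlim_at less_imp_neq[symmetric]\<close>)
    qed
    fix n
    show "AE x in lborel. norm (s n x) \<le> (2 ^ k * M) * weight x"
    proof (rule AE_I2)
      fix x :: "real^'n"
      have "norm (g (x + t n *\<^sub>R axis i 1) - g x) \<le> ((2 ^ k * M) * weight x) * t n"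
      proof (rule increment_bound[OF gp])
        fix r assume r: "0 \<le> r" "r \<le> t n"
        have "(1 + norm x) ^ k * norm (partial i g (x + r *\<^sub>R axis i 1)) \<le> 2 ^ k * M"
          using r tp[of n] by (intro weight_shift[OF _ M(2) semi_bound[OF M(1)]]) (auto simp: norm_axis_1)
        moreover have "0 < (1 + norm x) ^ k" by (simp add: add_pos_nonneg)
        ultimately show "norm (partial i g (x + r *\<^sub>R axis i 1)) \<le> (2 ^ k * M) * weight x"
          by (simp add: field_simps k_def)
      qed (use tp[of n] in auto)
      then have "inverse (t n) * norm (g (x + t n *\<^sub>R axis i 1) - g x) \<le>
          inverse (t n) * (((2 ^ k * M) * weight x) * t n)"
        using tp(1)[of n] by (intro mult_left_mono) auto
      also have "inverse (t n) * (((2 ^ k * M) * weight x) * t n) = (2 ^ k * M) * weight x"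
        using tp(1)[of n] by (simp add: field_simps)
      finally show "norm (s n x) \<le> (2 ^ k * M) * weight x"
        using tp(1)[of n] by (simp add: s_def)
    qed
  qed (auto intro: sm gm')
  moreover have "integral\<^sup>L lborel (s n) = 0" for n
  proof -
    have "integral\<^sup>L lborel (s n) = ((\<integral>x. g (x + t n *\<^sub>R axis i 1) \<partial>lborel) - (\<integral>x. g x \<partial>lborel)) /\<^sub>R t n"
      unfolding s_def using gi integrable_translate[OF gi]
      by (subst integral_scaleR_right) (auto simp: Bochner_Integration.integral_diff)
    then show ?thesis by (simp add: integral_translate)
  qed
  ultimately show ?thesis by (simp add: LIMSEQ_const_iff)
qed

section \<open>Coordinate functions and characters as multipliers\<close>

lemma has_partial_coord: "has_partial j (\<lambda>x. of_real (x $ i)) (\<lambda>x. if i = j then 1 else 0)"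
  unfolding has_partial_def
proof
  fix x :: "real^'a"
  have "((\<lambda>t. complex_of_real (x $ i) + complex_of_real t * (if i = j then 1 else 0)) has_vector_derivative
     (if i = j then 1 else 0)) (at 0)"
    by (auto intro!: derivative_eq_intros)
  moreover have "complex_of_real ((x + t *\<^sub>R axis j 1) $ i) = complex_of_real (x $ i) + complex_of_real t * (if i = j then 1 else 0)" for t
    by (simp add: axis_def)
  ultimately show "((\<lambda>t. complex_of_real ((x + t *\<^sub>R axis j 1) $ i)) has_vector_derivative
     (if i = j then 1 else 0)) (at 0)"
    by presburger
qed

lemma smooth_coord: "smooth (\<lambda>x. complex_of_real (x $ i))"
\<comment> \<open>Differentiating a coordinate gives a constant, which is already known to be
  smooth; the second disjunct takes care of it.\<close>
proof (rule smooth_coinduct[where P="\<lambda>g. g = (\<lambda>x. of_real (x $ i)) \<or> smooth g"])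
  fix g :: "'a test" and j
  assume g: "g = (\<lambda>x. of_real (x $ i)) \<or> smooth g"
  show "continuous_on UNIV g" using g smooth_continuous_on by (auto intro!: continuous_intros)
  show "\<exists>g'. (g' = (\<lambda>x. of_real (x $ i)) \<or> smooth g') \<and> has_partial j g g'"
    using g has_partial_coord smooth_const smooth_has_partial by blast
qed auto

text \<open>Only the undifferentiated function grows, and linearly; every proper derivative is a
  constant of modulus at most 1.\<close>

lemma Dpar_coord_bound: "norm (Dpar es (\<lambda>x. complex_of_real (x $ i)) x) \<le> 1 * (1 + norm x) ^ 1"
proof -
  have "\<exists>c. norm c \<le> 1 \<and> Dpar (j # es) (\<lambda>x. complex_of_real (x $ i)) = (\<lambda>x. c)" for j es
  proof (induction es arbitrary: j)
    case Nil
    then show ?case using has_partial_imp_partial[OF has_partial_coord[of j i]]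
      by (intro exI[of _ "if i = j then 1 else 0"]) auto
  next
    case (Cons k es)
    then obtain c where "Dpar (k # es) (\<lambda>x. complex_of_real (x $ i)) = (\<lambda>x. c)" by blast
    then show ?case using has_partial_imp_partial[OF has_partial_const, of j c] by (intro exI[of _ 0]) auto
  qed
  then have "Dpar es (\<lambda>x. complex_of_real (x $ i)) x = of_real (x $ i) \<or>
      norm (Dpar es (\<lambda>x. complex_of_real (x $ i)) x) \<le> 1"
    by (cases es) (auto, metis Dpar.simps(2))
  then show ?thesis
    using component_le_norm_cart[of x i] norm_ge_zero[of x] by (auto simp del: norm_ge_zero)
qed

lemma schwartz_coord: "schwartz \<phi> \<Longrightarrow> schwartz (\<lambda>x. of_real (x $ i) * \<phi> x)"
  using Dpar_coord_bound by (intro schwartz_mult smooth_coord) blast+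

lemma semi_coord:
  assumes "schwartz \<phi>" "semi (Suc N) \<phi> M"
  shows "semi N (\<lambda>x. of_real (x $ i) * \<phi> x) (2 ^ N * M)"
  using semi_mult[OF smooth_coord schwartz_smooth[OF assms(1)] _ Dpar_coord_bound, of N M i] assms by simp

lemma has_partial_cis: "has_partial i (\<lambda>x. cis (a \<bullet> x)) (\<lambda>x. \<i> * of_real (a $ i) * cis (a \<bullet> x))"
  unfolding has_partial_def
proof
  fix x :: "real^'a"
  have "((\<lambda>t. cis (a \<bullet> x + t * (a $ i))) has_vector_derivative (\<i> * of_real (a $ i) * cis (a \<bullet> x))) (at 0)"
    unfolding cis_conv_exp
    by (auto intro!: derivative_eq_intros has_vector_derivative_real_field simp: algebra_simps)
  then show "((\<lambda>t. cis (a \<bullet> (x + t *\<^sub>R axis i 1))) has_vector_derivative (\<i> * of_real (a $ i) * cis (a \<bullet> x))) (at 0)"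
    by (simp add: inner_add_right inner_axis)
qed

lemma Dpar_cis:
  "Dpar es (\<lambda>x. cis (a \<bullet> x)) = (\<lambda>x. (\<Prod>i\<leftarrow>es. \<i> * of_real (a $ i)) * cis (a \<bullet> x))"
proof (induction es)
  case (Cons i es)
  then show ?case
    using has_partial_imp_partial[OF has_partial_cmult[OF has_partial_cis[of i a], of "\<Prod>i\<leftarrow>es. \<i> * of_real (a $ i)"]]
    by (simp add: mult_ac)
qed simp

lemma smooth_cis: "smooth (\<lambda>x. cis (a \<bullet> x))"
proof (rule smooth_coinduct[where P="\<lambda>g. \<exists>c. g = (\<lambda>x. c * cis (a \<bullet> x))"])
  fix g :: "'a test" and i
  assume "\<exists>c. g = (\<lambda>x. c * cis (a \<bullet> x))"
  then obtain c where g: "g = (\<lambda>x. c * cis (a \<bullet> x))" by blast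
  show "continuous_on UNIV g" unfolding g by (intro continuous_intros)
  show "\<exists>g'. (\<exists>c. g' = (\<lambda>x. c * cis (a \<bullet> x))) \<and> has_partial i g g'"
    unfolding g using has_partial_cmult[OF has_partial_cis[of i a], of c]
    by (intro exI[of _ "\<lambda>x. (c * (\<i> * of_real (a $ i))) * cis (a \<bullet> x)"] conjI exI[of _ "c * (\<i> * of_real (a $ i))"])
       (simp_all add: mult_ac)
qed (auto intro: exI[of _ 1])

lemma schwartz_cis:
  assumes "schwartz \<phi>"
  shows "schwartz (\<lambda>x. cis (a \<bullet> x) * \<phi> x)"
proof (rule schwartz_mult[OF smooth_cis assms])
  fix N
  have "norm (\<Prod>i\<leftarrow>es. \<i> * complex_of_real (a $ i)) \<le> (1 + norm a) ^ length es" for es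
  proof (induction es)
    case (Cons i es)
    have "\<bar>a $ i\<bar> \<le> 1 + norm a" using component_le_norm_cart[of a i] by simp
    with Cons show ?case by (auto simp: norm_mult intro!: mult_mono)
  qed simp
  moreover have "(1 + norm a) ^ length es \<le> (1 + norm a) ^ N" if "length es \<le> N" for es :: "'a list"
    using that by (intro power_increasing) auto
  ultimately have "\<forall>es x. length es \<le> N \<longrightarrow> norm (Dpar es (\<lambda>x. cis (a \<bullet> x)) x) \<le> (1 + norm a) ^ N * (1 + norm x) ^ 0"
    by (auto simp: Dpar_cis norm_mult intro: order.trans)
  then show "\<exists>A k. \<forall>es x. length es \<le> N \<longrightarrow> norm (Dpar es (\<lambda>x. cis (a \<bullet> x)) x) \<le> A * (1 + norm x) ^ k"
    by blast
qed

section \<open>The Fourier integral on Schwartz functions\<close>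

text \<open>The unnormalised integral with a free factor in the exponent: -1 gives the Fourier
  transform and 1, up to a constant, its inverse, so that all estimates are proved once.\<close>

definition ft :: "real \<Rightarrow> ('n::finite) test \<Rightarrow> 'n test" where
  "ft \<sigma> \<phi> \<xi> = (\<integral>x. cis (\<sigma> * (x \<bullet> \<xi>)) * \<phi> x \<partial>lborel)"

lemma fourier_eq_ft: "fourier \<phi> = ft (- 1) \<phi>"
  by (simp add: fun_eq_iff fourier_def ft_def mult.commute)

lemma inv_fourier_eq_ft:
  fixes \<phi> :: "('n::finite) test"
  shows "inv_fourier \<phi> = (\<lambda>x. complex_of_real ((2 * pi) powr (- real CARD('n))) * ft 1 \<phi> x)"
  by (simp add: fun_eq_iff inv_fourier_def ft_def mult.commute inner_commute)

lemma ft_integrable: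
  assumes "schwartz \<phi>"
  shows "integrable lborel (\<lambda>x. cis (\<sigma> * (x \<bullet> \<xi>)) * \<phi> x)"
  using schwartz_integrable[OF schwartz_cis[OF assms, of "\<sigma> *\<^sub>R \<xi>"]] by (simp add: inner_commute)

lemma ft_add: "schwartz f \<Longrightarrow> schwartz g \<Longrightarrow> ft \<sigma> (\<lambda>x. f x + g x) = (\<lambda>\<xi>. ft \<sigma> f \<xi> + ft \<sigma> g \<xi>)"
  by (simp add: ft_def fun_eq_iff distrib_left ft_integrable)

lemma ft_cmult: "ft \<sigma> (\<lambda>x. c * f x) = (\<lambda>\<xi>. c * ft \<sigma> f \<xi>)"
  by (simp add: ft_def fun_eq_iff mult.left_commute)

lemma ft_modulate: "ft 1 (\<lambda>x. cis (a \<bullet> x) * f x) = (\<lambda>\<xi>. ft 1 f (\<xi> + a))"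
  by (simp add: ft_def fun_eq_iff inner_add_right flip: mult.assoc cis_mult) (simp add: inner_commute)

lemma ft_bound:
  assumes "schwartz \<phi>" "semi (2 * CARD('n)) (\<phi> :: ('n::finite) test) M"
  shows "norm (ft \<sigma> \<phi> \<xi>) \<le> M * (\<integral>x. weight (x :: real^'n) \<partial>lborel)"
  unfolding ft_def
  using assms semi_bound[OF assms(2)] borel_measurable_integrable[OF ft_integrable[OF assms(1)]]
  by (intro weighted_integrable) (auto simp: norm_mult)

text \<open>Integration by parts, obtained by applying \<open>integral_partial_zero\<close> to the
  product of the character with \<phi>.\<close>

lemma ft_partial:
  assumes "schwartz \<phi>"
  shows "ft \<sigma> (partial i \<phi>) \<xi> = - (\<i> * of_real (\<sigma> * \<xi> $ i)) * ft \<sigma> \<phi> \<xi>"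
proof -
  define a where "a = \<sigma> *\<^sub>R \<xi>"
  have a: "\<sigma> * (x \<bullet> \<xi>) = a \<bullet> x" for x by (simp add: a_def inner_commute)
  have i1: "integrable lborel (\<lambda>x. cis (a \<bullet> x) * partial i \<phi> x)"
    using schwartz_cis[OF schwartz_partial[OF assms]] schwartz_integrable by blast
  have i2: "integrable lborel (\<lambda>x. \<i> * of_real (a $ i) * (cis (a \<bullet> x) * \<phi> x))"
    using schwartz_integrable[OF schwartz_cis[OF assms]] by (intro integrable_mult_right)
  have "partial i (\<lambda>x. cis (a \<bullet> x) * \<phi> x) =
     (\<lambda>x. cis (a \<bullet> x) * partial i \<phi> x + \<i> * of_real (a $ i) * cis (a \<bullet> x) * \<phi> x)"
    using assms by (intro has_partial_imp_partial has_partial_mult has_partial_cis smooth_has_partial schwartz_smooth)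
  then have "0 = (\<integral>x. cis (a \<bullet> x) * partial i \<phi> x + \<i> * of_real (a $ i) * (cis (a \<bullet> x) * \<phi> x) \<partial>lborel)"
    using integral_partial_zero[OF schwartz_cis[OF assms, of a], of i] by (simp add: mult.assoc)
  also have "\<dots> = ft \<sigma> (partial i \<phi>) \<xi> + \<i> * of_real (a $ i) * ft \<sigma> \<phi> \<xi>"
    using i1 i2 by (simp add: ft_def a)
  finally show ?thesis by (simp add: a_def add_eq_0_iff)
qed

lemma has_vector_derivative_quadratic:
  fixes f :: "real \<Rightarrow> 'a::real_normed_vector"
  assumes "\<And>t. norm (f t - f 0 - t *\<^sub>R D) \<le> K * t\<^sup>2"
  shows "(f has_vector_derivative D) (at 0)"
  unfolding has_vector_derivative_def has_derivative_at_alt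
proof (intro conjI allI impI)
  fix e :: real assume e: "e > 0"
  show "\<exists>d>0. \<forall>y. norm (y - 0) < d \<longrightarrow> norm (f y - f 0 - (y - 0) *\<^sub>R D) \<le> e * norm (y - 0)"
  proof (intro exI[of _ "e / (\<bar>K\<bar> + 1)"] conjI allI impI)
    fix y :: real assume y: "norm (y - 0) < e / (\<bar>K\<bar> + 1)"
    have "norm (f y - f 0 - (y - 0) *\<^sub>R D) \<le> K * y\<^sup>2" using assms[of y] by simp
    also have "\<dots> \<le> (\<bar>K\<bar> + 1) * \<bar>y\<bar> * \<bar>y\<bar>"
      by (simp add: power2_eq_square mult_right_mono flip: abs_mult mult.assoc) (simp add: abs_mult mult.assoc mult_right_mono)
    also have "\<dots> \<le> e * \<bar>y\<bar>"
      using y by (intro mult_right_mono) (auto simp: field_simps)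
    finally show "norm (f y - f 0 - (y - 0) *\<^sub>R D) \<le> e * norm (y - 0)" by simp
  qed (use e in \<open>simp add: divide_pos_pos add_nonneg_pos\<close>)
qed (rule bounded_linear_scaleR_left)

lemma cis_second_order: "norm (cis y - 1 - \<i> * of_real y) \<le> y\<^sup>2"
proof -
  have "2 * norm (cis y - 1 - \<i> * of_real y) \<le> y\<^sup>2"
    using iexp_approx1[of y 1] by (simp add: cis_conv_exp algebra_simps power2_eq_square)
  then show ?thesis using norm_ge_zero[of "cis y - 1 - \<i> * of_real y"] by linarith
qed

text \<open>The first-order Taylor remainder of \<open>cis\<close> at y is at most y^2. After
  integration the error is therefore at most t^2 times a second moment of \<phi>, which settles
  differentiation under the integral sign without a limit argument.\<close>

lemma ft_has_partial:
  assumes "schwartz \<phi>"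
  shows "has_partial i (ft \<sigma> \<phi>) (ft \<sigma> (\<lambda>x. (\<i> * of_real \<sigma>) * (of_real (x $ i) * \<phi> x)))"
  unfolding has_partial_def
proof
  fix \<xi> :: "real^'a"
  let ?D = "ft \<sigma> (\<lambda>x. (\<i> * of_real \<sigma>) * (of_real (x $ i) * \<phi> x)) \<xi>"
  have s1: "schwartz (\<lambda>x. (\<i> * of_real \<sigma>) * (of_real (x $ i) * \<phi> x))"
    using assms by (intro schwartz_cmult schwartz_coord)
  have s2: "integrable lborel (\<lambda>x. norm (of_real (x $ i) * (of_real (x $ i) * \<phi> x)))"
    using assms by (intro integrable_norm schwartz_integrable schwartz_coord)
  define K where "K = \<sigma>\<^sup>2 * (\<integral>x. norm (of_real (x $ i) * (of_real (x $ i) * \<phi> x)) \<partial>lborel)"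
  have "norm (ft \<sigma> \<phi> (\<xi> + t *\<^sub>R axis i 1) - ft \<sigma> \<phi> (\<xi> + 0 *\<^sub>R axis i 1) - t *\<^sub>R ?D) \<le> K * t\<^sup>2" for t
  proof -
    let ?r = "\<lambda>x. cis (\<sigma> * (x \<bullet> \<xi>)) * \<phi> x * (cis (\<sigma> * t * x $ i) - 1 - \<i> * of_real (\<sigma> * t * x $ i))"
    have e: "cis (\<sigma> * (x \<bullet> (\<xi> + t *\<^sub>R axis i 1))) * \<phi> x - cis (\<sigma> * (x \<bullet> \<xi>)) * \<phi> x -
      t *\<^sub>R (cis (\<sigma> * (x \<bullet> \<xi>)) * ((\<i> * of_real \<sigma>) * (of_real (x $ i) * \<phi> x))) = ?r x" for x
    proof -
      have "cis (\<sigma> * (x \<bullet> (\<xi> + t *\<^sub>R axis i 1))) = cis (\<sigma> * (x \<bullet> \<xi>)) * cis (\<sigma> * t * x $ i)"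
        by (simp add: cis_mult inner_add_right inner_axis algebra_simps)
      then show ?thesis by (simp only: scaleR_conv_of_real) (simp add: algebra_simps)
    qed
    have i: "integrable lborel ?r"
      unfolding e[symmetric] using assms s1
      by (intro Bochner_Integration.integrable_diff integrable_scaleR_right ft_integrable)
    have "ft \<sigma> \<phi> (\<xi> + t *\<^sub>R axis i 1) - ft \<sigma> \<phi> (\<xi> + 0 *\<^sub>R axis i 1) - t *\<^sub>R ?D = integral\<^sup>L lborel ?r"
      unfolding e[symmetric] ft_def using assms s1
      by (simp add: Bochner_Integration.integral_diff ft_integrable del: scaleR_conv_of_real)
    also have "norm \<dots> \<le> (\<integral>x. (\<sigma>\<^sup>2 * t\<^sup>2) * norm (of_real (x $ i) * (of_real (x $ i) * \<phi> x)) \<partial>lborel)"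
    proof (rule norm_integral_le_integral[OF i integrable_mult_right[OF s2]])
      fix x
      have "norm (?r x) \<le> norm (\<phi> x) * (\<sigma> * t * x $ i)\<^sup>2"
        using mult_left_mono[OF cis_second_order[of "\<sigma> * t * x $ i"], of "norm (\<phi> x)"] by (simp add: norm_mult)
      then show "norm (?r x) \<le> (\<sigma>\<^sup>2 * t\<^sup>2) * norm (of_real (x $ i) * (of_real (x $ i) * \<phi> x))"
        by (simp add: norm_mult power_mult_distrib power2_eq_square mult_ac abs_mult_self_eq flip: abs_mult)
    qed
    also have "\<dots> = K * t\<^sup>2" by (simp add: K_def)
    finally show ?thesis .
  qed
  then show "((\<lambda>t. ft \<sigma> \<phi> (\<xi> + t *\<^sub>R axis i 1)) has_vector_derivative ?D) (at 0)"
    by (rule has_vector_derivative_quadratic)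
qed

lemma ft_continuous:
  assumes "schwartz \<phi>"
  shows "continuous_on UNIV (ft \<sigma> \<phi>)"
  unfolding continuous_on_eq_continuous_at[OF open_UNIV]
proof (intro ballI continuous_at_sequentiallyI)
  fix \<xi> :: "real^'a" and u assume u: "u \<longlonglongrightarrow> \<xi>"
  show "(\<lambda>n. ft \<sigma> \<phi> (u n)) \<longlonglongrightarrow> ft \<sigma> \<phi> \<xi>"
    unfolding ft_def
  proof (rule integral_dominated_convergence[where w="\<lambda>x. norm (\<phi> x)"])
    show "AE x in lborel. (\<lambda>n. cis (\<sigma> * (x \<bullet> u n)) * \<phi> x) \<longlonglongrightarrow> cis (\<sigma> * (x \<bullet> \<xi>)) * \<phi> x"
      by (intro AE_I2 tendsto_intros u)
  qed (use assms schwartz_integrable borel_measurable_integrable[OF ft_integrable] in \<open>auto simp: norm_mult\<close>)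
qed

text \<open>The invariant class consists of the transforms of Schwartz functions: a derivative of a
  transform is the transform of a coordinate multiple, again Schwartz.\<close>

lemma ft_smooth:
  assumes "schwartz \<phi>"
  shows "smooth (ft \<sigma> \<phi>)"
  by (rule smooth_coinduct[where P="\<lambda>g. \<exists>\<phi>. schwartz \<phi> \<and> g = ft \<sigma> \<phi>"])
     (use assms in \<open>auto intro: ft_continuous\<close>, use schwartz_cmult schwartz_coord ft_has_partial in blast)

text \<open>A power of |xi| is bounded through the coordinates, and each coordinate is traded for a
  derivative of \<phi> by \<open>ft_partial\<close>; this divides by \<sigma>. \<open>N\<close> and
  \<open>C\<close> are chosen before \<phi>, as continuity on the Schwartz space requires.\<close>

lemma ft_decay:
  assumes "\<sigma> \<noteq> 0"
  shows "\<exists>N C. 0 \<le> C \<and> (\<forall>\<phi> M. schwartz \<phi> \<longrightarrow> semi N (\<phi> :: ('n::finite) test) M \<longrightarrow>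
      (\<forall>\<xi>. (1 + norm \<xi>) ^ m * norm (ft \<sigma> \<phi> \<xi>) \<le> C * M))"
proof (induction m)
  case 0
  have "0 \<le> (\<integral>x. weight (x :: real^'n) \<partial>lborel)" by (intro integral_nonneg_AE) auto
  then show ?case
    by (intro exI[of _ "2 * CARD('n)"] exI[of _ "\<integral>x. weight (x :: real^'n) \<partial>lborel"])
       (auto intro: ft_bound[THEN order.trans] simp: mult.commute)
next
  case (Suc m)
  then obtain N C where C: "0 \<le> C" and NC: "\<And>\<phi> M \<xi>. schwartz \<phi> \<Longrightarrow> semi N (\<phi> :: 'n test) M \<Longrightarrow>
      (1 + norm \<xi>) ^ m * norm (ft \<sigma> \<phi> \<xi>) \<le> C * M" by blast
  let ?C = "C + (\<Sum>i\<in>(UNIV::'n set). C / \<bar>\<sigma>\<bar>)"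
  show ?case
  proof (intro exI[of _ "Suc N"] exI[of _ ?C] conjI allI impI)
    show "0 \<le> ?C" using C by (auto intro!: add_nonneg_nonneg sum_nonneg)
    fix \<phi> :: "'n test" and M and \<xi> :: "real^'n" assume \<phi>: "schwartz \<phi>" "semi (Suc N) \<phi> M"
    have "1 + norm \<xi> \<le> 1 + (\<Sum>i\<in>UNIV. \<bar>\<xi> $ i\<bar>)" using norm_le_l1_cart[of \<xi>] by simp
    then have "(1 + norm \<xi>) ^ Suc m * norm (ft \<sigma> \<phi> \<xi>) \<le> (1 + (\<Sum>i\<in>UNIV. \<bar>\<xi> $ i\<bar>)) * ((1 + norm \<xi>) ^ m * norm (ft \<sigma> \<phi> \<xi>))"
      by (auto simp: mult.assoc intro!: mult_right_mono)
    also have "\<dots> = (1 + norm \<xi>) ^ m * norm (ft \<sigma> \<phi> \<xi>) + (\<Sum>i\<in>UNIV. \<bar>\<xi> $ i\<bar> * ((1 + norm \<xi>) ^ m * norm (ft \<sigma> \<phi> \<xi>)))"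
      by (simp add: distrib_right sum_distrib_right)
    also have "\<dots> \<le> C * M + (\<Sum>i\<in>(UNIV::'n set). C / \<bar>\<sigma>\<bar> * M)"
    proof (intro add_mono sum_mono)
      show "(1 + norm \<xi>) ^ m * norm (ft \<sigma> \<phi> \<xi>) \<le> C * M"
        using \<phi> semi_antimono[OF \<phi>(2), of N] by (intro NC) auto
      fix i
      have "(1 + norm \<xi>) ^ m * norm (ft \<sigma> (partial i \<phi>) \<xi>) \<le> C * M"
        using \<phi> by (intro NC schwartz_partial semi_partial)
      then have "\<bar>\<sigma>\<bar> * (\<bar>\<xi> $ i\<bar> * ((1 + norm \<xi>) ^ m * norm (ft \<sigma> \<phi> \<xi>))) \<le> C * M"
        by (simp add: ft_partial[OF \<phi>(1)] norm_mult abs_mult mult_ac)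
      then show "\<bar>\<xi> $ i\<bar> * ((1 + norm \<xi>) ^ m * norm (ft \<sigma> \<phi> \<xi>)) \<le> C / \<bar>\<sigma>\<bar> * M"
        using assms by (simp add: field_simps)
    qed
    also have "\<dots> = ?C * M" by (simp add: algebra_simps)
    finally show "(1 + norm \<xi>) ^ Suc m * norm (ft \<sigma> \<phi> \<xi>) \<le> ?C * M" .
  qed
qed

lemma semi_cmult:
  assumes "smooth \<phi>" "semi N \<phi> M"
  shows "semi N (\<lambda>x. c * \<phi> x) (norm c * M)"
  unfolding semi_def Dpar_cmult[OF assms(1)] norm_mult
proof (intro allI impI)
  fix x :: "real^'a" and ds :: "'a list" assume "length ds \<le> N"
  then have "norm c * ((1 + norm x) ^ N * norm (Dpar ds \<phi> x)) \<le> norm c * M"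
    using assms(2) by (intro mult_left_mono) (auto simp: semi_def)
  then show "(1 + norm x) ^ N * (norm c * norm (Dpar ds \<phi> x)) \<le> norm c * M"
    by (simp add: mult_ac)
qed

text \<open>The innermost derivative of a transform is the transform of a coordinate multiple, so
  one derivative is exchanged for one more seminorm index. In the inductive step only lists of
  length exactly \<open>Suc n\<close> are new.\<close>

lemma ft_Dpar_decay:
  assumes "\<sigma> \<noteq> 0"
  shows "\<exists>N C. 0 \<le> C \<and> (\<forall>\<phi> M. schwartz \<phi> \<longrightarrow> semi N (\<phi> :: ('n::finite) test) M \<longrightarrow>
      (\<forall>ds \<xi>. length ds \<le> n \<longrightarrow> (1 + norm \<xi>) ^ m * norm (Dpar ds (ft \<sigma> \<phi>) \<xi>) \<le> C * M))"
proof (induction n)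
  case 0
  then show ?case using ft_decay[OF assms, of m] by simp
next
  case (Suc n)
  then obtain N C where C: "0 \<le> C" and NC: "\<And>\<phi> M ds \<xi>. schwartz \<phi> \<Longrightarrow> semi N (\<phi> :: 'n test) M \<Longrightarrow>
     length ds \<le> n \<Longrightarrow> (1 + norm \<xi>) ^ m * norm (Dpar ds (ft \<sigma> \<phi>) \<xi>) \<le> C * M" by blast
  let ?C = "C + C * (\<bar>\<sigma>\<bar> * 2 ^ N)"
  show ?case
  proof (intro exI[of _ "Suc N"] exI[of _ ?C] conjI allI impI)
    show "0 \<le> ?C" using C by auto
    fix \<phi> :: "'n test" and M and \<xi> :: "real^'n" and ds :: "'n list"
    assume \<phi>: "schwartz \<phi>" "semi (Suc N) \<phi> M" and ds: "length ds \<le> Suc n"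
    have M: "0 \<le> M" using \<phi> semi_nonneg by blast
    show "(1 + norm \<xi>) ^ m * norm (Dpar ds (ft \<sigma> \<phi>) \<xi>) \<le> ?C * M"
    proof (cases "length ds \<le> n")
      case True
      then have "(1 + norm \<xi>) ^ m * norm (Dpar ds (ft \<sigma> \<phi>) \<xi>) \<le> C * M"
        using \<phi> semi_antimono[OF \<phi>(2), of N] by (intro NC) auto
      also have "\<dots> \<le> ?C * M" using M C by (intro mult_right_mono) auto
      finally show ?thesis .
    next
      case False
      then obtain es i where es: "ds = es @ [i]" by (cases ds rule: rev_cases) auto
      let ?\<phi> = "\<lambda>x. (\<i> * of_real \<sigma>) * (of_real (x $ i) * \<phi> x)"
      have "semi N ?\<phi> (norm (\<i> * of_real \<sigma>) * (2 ^ N * M))"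
        using \<phi> by (intro semi_cmult semi_coord schwartz_smooth schwartz_coord)
      then have "(1 + norm \<xi>) ^ m * norm (Dpar es (ft \<sigma> ?\<phi>) \<xi>) \<le> C * (norm (\<i> * of_real \<sigma>) * (2 ^ N * M))"
        using \<phi> ds es by (intro NC schwartz_cmult schwartz_coord) auto
      also have "\<dots> \<le> ?C * M" using M C by (simp add: norm_mult algebra_simps)
      finally show ?thesis
        using has_partial_imp_partial[OF ft_has_partial[OF \<phi>(1), of i \<sigma>]] by (simp add: es Dpar_snoc)
    qed
  qed
qed

lemma ft_semi:
  assumes "\<sigma> \<noteq> 0"
  shows "\<exists>N' C. 0 \<le> C \<and> (\<forall>\<phi> M. schwartz \<phi> \<longrightarrow> semi N' (\<phi> :: ('n::finite) test) M \<longrightarrow> semi N (ft \<sigma> \<phi>) (C * M))"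
  using ft_Dpar_decay[OF assms, of N N] unfolding semi_def by meson

lemma ft_schwartz:
  assumes "\<sigma> \<noteq> 0" "schwartz \<phi>"
  shows "schwartz (ft \<sigma> \<phi>)"
  using ft_semi[OF assms(1)] assms(2) ft_smooth unfolding schwartz_iff_semi by meson

section \<open>Gaussians, approximate identities and Fourier inversion\<close>

lemma cis_measurable [measurable]: "cis \<in> borel_measurable borel"
  by (intro borel_measurable_continuous_onI continuous_intros)

lemma integral_lborel_prod:
  fixes f :: "'a::euclidean_space \<Rightarrow> real \<Rightarrow> complex"
  assumes "\<And>b. b \<in> Basis \<Longrightarrow> integrable lborel (f b)"
  shows "integrable lborel (\<lambda>x. \<Prod>b\<in>Basis. f b (x \<bullet> b))" (is ?I)
    and "(\<integral>x. (\<Prod>b\<in>Basis. f b (x \<bullet> b)) \<partial>lborel) = (\<Prod>b\<in>Basis. integral\<^sup>L lborel (f b))" (is ?E)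
proof -
  interpret product_sigma_finite "\<lambda>_ :: 'a. lborel :: real measure" ..
  let ?T = "\<lambda>g. \<Sum>b\<in>(Basis :: 'a set). g b *\<^sub>R b"
  have [measurable]: "f b \<in> borel_measurable borel" if "b \<in> Basis" for b
    using borel_measurable_integrable[OF assms[OF that]] by simp
  have m: "(\<lambda>x. \<Prod>b\<in>Basis. f b (x \<bullet> b)) \<in> borel_measurable borel" by measurable
  have T: "?T \<in> measurable (\<Pi>\<^sub>M b\<in>Basis. lborel) borel" by measurable
  have e: "(\<Prod>b\<in>Basis. f b (?T g \<bullet> b)) = (\<Prod>b\<in>Basis. f b (g b))" for g by simp
  have "integrable (\<Pi>\<^sub>M b\<in>Basis. lborel) (\<lambda>g. \<Prod>b\<in>Basis. f b (g b))"
    using assms by (intro product_integrable_prod) auto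
  then show ?I
    by (subst lborel_eq) (simp add: integrable_distr_eq[OF T m] e)
  have "(\<integral>g. (\<Prod>b\<in>Basis. f b (g b)) \<partial>(\<Pi>\<^sub>M b\<in>Basis. lborel)) = (\<Prod>b\<in>Basis. integral\<^sup>L lborel (f b))"
    using assms by (intro product_integral_prod) auto
  then show ?E
    by (subst lborel_eq) (simp add: integral_distr[OF T m] e)
qed

text \<open>Up to the normalisation sqrt(2 pi) this is the characteristic function of the standard
  normal distribution.\<close>

lemma gaussian_ft_1d:
  fixes t :: real
  shows "integrable lborel (\<lambda>x. cis (x * t) * of_real (exp (- x\<^sup>2 / 2)))"
    and "(\<integral>x. cis (x * t) * of_real (exp (- x\<^sup>2 / 2)) \<partial>lborel) = of_real (sqrt (2 * pi) * exp (- t\<^sup>2 / 2))"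
proof -
  have e: "cis (x * t) * of_real (exp (- x\<^sup>2 / 2)) = of_real (sqrt (2 * pi)) * (std_normal_density x *\<^sub>R iexp (t * x))" for x
    by (simp add: std_normal_density_def cis_conv_exp scaleR_conv_of_real mult_ac exp_of_real)
  have "integrable std_normal_distribution (\<lambda>x. iexp (t * x))"
    using prob_space.integrable_iexp[OF prob_space_normal_density[of 1 0], of "\<lambda>x. t * x"] by simp
  then have "integrable lborel (\<lambda>x. std_normal_density x *\<^sub>R iexp (t * x))"
    by (subst (asm) integrable_density) auto
  then show "integrable lborel (\<lambda>x. cis (x * t) * of_real (exp (- x\<^sup>2 / 2)))"
    unfolding e by (rule integrable_mult_right)
  have "char std_normal_distribution t = (\<integral>x. std_normal_density x *\<^sub>R iexp (t * x) \<partial>lborel)"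
    unfolding char_def by (subst integral_density) auto
  then have "(\<integral>x. std_normal_density x *\<^sub>R iexp (t * x) \<partial>lborel) = of_real (exp (- t\<^sup>2 / 2))"
    by (simp add: char_std_normal_distribution)
  then show "(\<integral>x. cis (x * t) * of_real (exp (- x\<^sup>2 / 2)) \<partial>lborel) = of_real (sqrt (2 * pi) * exp (- t\<^sup>2 / 2))"
    unfolding e by (simp only: integral_mult_right_zero of_real_mult)
qed

definition gauss :: "'a::euclidean_space \<Rightarrow> complex" where
  "gauss x = of_real (exp (- (norm x)\<^sup>2 / 2))"

lemma gauss_prod: "gauss x = (\<Prod>b\<in>Basis. of_real (exp (- (x \<bullet> b)\<^sup>2 / 2)))"
proof -
  have "(norm x)\<^sup>2 = (\<Sum>b\<in>Basis. (x \<bullet> b)\<^sup>2)"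
    unfolding power2_norm_eq_inner by (subst euclidean_inner) (simp add: power2_eq_square)
  then have "exp (- (norm x)\<^sup>2 / 2) = (\<Prod>b\<in>Basis. exp (- (x \<bullet> b)\<^sup>2 / 2))"
    by (simp add: exp_sum[symmetric] sum_negf sum_divide_distrib)
  then show ?thesis by (simp add: gauss_def)
qed

lemma cis_inner_prod: "cis (x \<bullet> y) = (\<Prod>b\<in>Basis. cis ((x \<bullet> b) * (y \<bullet> b)))"
  by (subst euclidean_inner) (simp add: cis_conv_exp exp_sum sum_distrib_left)

lemma gauss_ft:
  fixes \<xi> :: "'a::euclidean_space"
  shows "integrable lborel (\<lambda>x. cis (x \<bullet> \<xi>) * gauss x)"
    and "(\<integral>x. cis (x \<bullet> \<xi>) * gauss x \<partial>lborel) = of_real (sqrt (2 * pi) ^ DIM('a)) * gauss \<xi>"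
proof -
  have e: "cis (x \<bullet> \<xi>) * gauss x = (\<Prod>b\<in>Basis. cis ((x \<bullet> b) * (\<xi> \<bullet> b)) * of_real (exp (- (x \<bullet> b)\<^sup>2 / 2)))" for x
    by (simp add: cis_inner_prod gauss_prod prod.distrib)
  show "integrable lborel (\<lambda>x. cis (x \<bullet> \<xi>) * gauss x)"
    unfolding e by (intro integral_lborel_prod gaussian_ft_1d)
  show "(\<integral>x. cis (x \<bullet> \<xi>) * gauss x \<partial>lborel) = of_real (sqrt (2 * pi) ^ DIM('a)) * gauss \<xi>"
    unfolding e using integral_lborel_prod(2)[OF gaussian_ft_1d(1), of "\<lambda>b. \<xi> \<bullet> b"]
    by (simp only: gaussian_ft_1d(2) of_real_mult prod.distrib gauss_prod) (simp add: of_real_power)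
qed

lemma gauss_integral:
  "integrable lborel (gauss :: 'a::euclidean_space \<Rightarrow> complex)"
  "(\<integral>x. gauss (x :: 'a) \<partial>lborel) = of_real (sqrt (2 * pi) ^ DIM('a))"
  using gauss_ft[of "0 :: 'a"] by (simp_all add: gauss_def[abs_def])

lemma integral_affine:
  fixes f :: "'a::euclidean_space \<Rightarrow> complex"
  assumes "c \<noteq> 0" "f \<in> borel_measurable borel"
  shows "(\<integral>x. f x \<partial>lborel) = \<bar>c\<bar> ^ DIM('a) *\<^sub>R (\<integral>x. f (t + c *\<^sub>R x) \<partial>lborel)"
  using assms by (subst lborel_affine[OF assms(1), of t]) (simp add: integral_density integral_distr)

lemma integrable_affine:
  fixes f :: "'a::euclidean_space \<Rightarrow> complex"
  assumes "c \<noteq> 0" "integrable lborel f"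
  shows "integrable lborel (\<lambda>x. f (t + c *\<^sub>R x))"
proof -
  have [measurable]: "f \<in> borel_measurable borel" using assms by auto
  have "integrable (density (distr lborel borel (\<lambda>x. t + c *\<^sub>R x)) (\<lambda>_. \<bar>c\<bar> ^ DIM('a))) f"
    using assms(2) by (subst (asm) lborel_affine[OF assms(1), of t]) simp
  then have *: "integrable lborel (\<lambda>x. \<bar>c\<bar> ^ DIM('a) *\<^sub>R f (t + c *\<^sub>R x))"
    by (subst (asm) integrable_density) (auto simp: integrable_distr_eq)
  have "integrable lborel (\<lambda>x. inverse (\<bar>c\<bar> ^ DIM('a)) *\<^sub>R (\<bar>c\<bar> ^ DIM('a) *\<^sub>R f (t + c *\<^sub>R x)))"
    by (rule integrable_scaleR_right) (rule *)
  then show ?thesis using assms(1) by simp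
qed

lemma approximate_identity:
  fixes b K :: "'a::euclidean_space \<Rightarrow> complex"
  assumes K: "integrable lborel K" and [measurable]: "b \<in> borel_measurable borel"
    and B: "\<And>x. norm (b x) \<le> B" and x: "isCont b x" and e: "e \<longlonglongrightarrow> 0"
  shows "(\<lambda>n. \<integral>z. K z * b (x + e n *\<^sub>R z) \<partial>lborel) \<longlonglongrightarrow> (\<integral>z. K z \<partial>lborel) * b x"
proof -
  have [measurable]: "K \<in> borel_measurable borel" using K by auto
  have "(\<lambda>n. \<integral>z. K z * b (x + e n *\<^sub>R z) \<partial>lborel) \<longlonglongrightarrow> (\<integral>z. K z * b x \<partial>lborel)"
  proof (rule integral_dominated_convergence[where w="\<lambda>z. norm (K z) * B"])
    show "AE z in lborel. (\<lambda>n. K z * b (x + e n *\<^sub>R z)) \<longlonglongrightarrow> K z * b x"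
    proof (intro AE_I2 tendsto_mult tendsto_const)
      fix z
      have "(\<lambda>n. x + e n *\<^sub>R z) \<longlonglongrightarrow> x" using e by (auto intro!: tendsto_eq_intros)
      then show "(\<lambda>n. b (x + e n *\<^sub>R z)) \<longlonglongrightarrow> b x" using x isCont_tendsto_compose by blast
    qed
    show "AE z in lborel. norm (K z * b (x + e n *\<^sub>R z)) \<le> norm (K z) * B" for n
      using B by (auto simp: norm_mult intro!: mult_left_mono)
  qed (use K in auto)
  then show ?thesis by simp
qed

text \<open>Supplies the joint integrability for the interchanges of integrals below: tensor
  products of integrable functions are integrable, and so is whatever they dominate.\<close>

lemma integrable_pair_bound:
  fixes f :: "'a::euclidean_space \<times> 'b::euclidean_space \<Rightarrow> complex"
  assumes g: "integrable lborel (g :: 'a \<Rightarrow> complex)" and h: "integrable lborel (h :: 'b \<Rightarrow> complex)"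
    and f [measurable]: "f \<in> borel_measurable (lborel \<Otimes>\<^sub>M lborel)"
    and b: "\<And>x y. norm (f (x, y)) \<le> A * norm (g x) * norm (h y)"
  shows "integrable (lborel \<Otimes>\<^sub>M lborel) f"
proof -
  have [measurable]: "g \<in> borel_measurable borel" "h \<in> borel_measurable borel" using g h by auto
  have "integrable (lborel \<Otimes>\<^sub>M lborel) (\<lambda>(x, y). of_real A * g x * h y)"
  proof (rule lborel_pair.Fubini_integrable)
    show "integrable lborel (\<lambda>x. \<integral>y. norm (case (x, y) of (x, y) \<Rightarrow> of_real A * g x * h y) \<partial>lborel)"
      using g h by (simp add: norm_mult)
    show "AE x in lborel. integrable lborel (\<lambda>y. case (x, y) of (x, y) \<Rightarrow> of_real A * g x * h y)"
      using h by simp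
  qed measurable
  then show ?thesis
  proof (rule Bochner_Integration.integrable_bound[OF _ f], intro AE_I2)
    fix z :: "'a \<times> 'b"
    show "norm (f z) \<le> norm (case z of (x, y) \<Rightarrow> of_real A * g x * h y)"
    proof (cases z)
      case (Pair x y)
      have "A * norm (g x) * norm (h y) \<le> \<bar>A\<bar> * norm (g x) * norm (h y)"
        by (intro mult_right_mono) auto
      with b[of x y] Pair show ?thesis by (simp add: norm_mult)
    qed
  qed
qed

text \<open>Gaussian regularisation: damping the outer integral by \<open>gauss (e \<xi>)\<close> turns it, by Fubini, into
  a convolution of \<open>h\<close> with a Gaussian approximate identity.\<close>

lemma ft_inversion:
  fixes h :: "('n::finite) test"
  assumes "schwartz h"
  shows "ft 1 (ft (- 1) h) x = of_real ((2 * pi) ^ CARD('n)) * h x"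
proof -
  define F where "F = ft (- 1) h"
  define e where "e n = inverse (real (Suc n))" for n
  have e0: "e \<longlonglongrightarrow> 0" unfolding e_def by (rule LIMSEQ_inverse_real_of_nat)
  have ep: "0 < e n" for n by (simp add: e_def)
  have F: "schwartz F" unfolding F_def using assms by (intro ft_schwartz) auto
  have [measurable]: "h \<in> borel_measurable borel" "F \<in> borel_measurable borel" using assms F by auto
  have gm [measurable]: "gauss \<in> borel_measurable (borel :: (real^'n) measure)"
    unfolding gauss_def[abs_def] by measurable
  obtain B where "semi 0 h B" using assms schwartz_iff_semi by blast
  then have B: "norm (h y) \<le> B" for y using semi_bound[of 0 h B y] by simp
  have hc: "isCont h x"
    using smooth_continuous_on[OF schwartz_smooth[OF assms], of UNIV] by (simp add: continuous_on_eq_continuous_at)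
  define A where "A n = (\<integral>\<xi>. cis (\<xi> \<bullet> x) * F \<xi> * gauss (e n *\<^sub>R \<xi>) \<partial>lborel)" for n
  have "A \<longlonglongrightarrow> (\<integral>\<xi>. cis (\<xi> \<bullet> x) * F \<xi> \<partial>lborel)"
    unfolding A_def
  proof (rule integral_dominated_convergence[where w="\<lambda>\<xi>. norm (F \<xi>)"])
    show "AE \<xi> in lborel. (\<lambda>n. cis (\<xi> \<bullet> x) * F \<xi> * gauss (e n *\<^sub>R \<xi>)) \<longlonglongrightarrow> cis (\<xi> \<bullet> x) * F \<xi>"
      unfolding gauss_def using e0 by (auto intro!: tendsto_eq_intros AE_I2)
  qed (use schwartz_integrable[OF F] in \<open>auto simp: norm_mult gauss_def intro!: mult_left_le\<close>)
  then have lim1: "A \<longlonglongrightarrow> ft 1 F x" by (simp add: ft_def)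
  have A: "A n = of_real (sqrt (2 * pi) ^ CARD('n)) * (\<integral>z. gauss z * h (x + e n *\<^sub>R z) \<partial>lborel)" for n
  proof -
    have ge: "integrable lborel (\<lambda>\<xi>::real^'n. gauss (e n *\<^sub>R \<xi>))"
      using integrable_affine[OF _ gauss_integral(1), of "e n" 0] ep[of n] by simp
    let ?f = "\<lambda>y \<xi>. cis (\<xi> \<bullet> (x - y)) * h y * gauss (e n *\<^sub>R \<xi>)"
    have "A n = (\<integral>\<xi>. (\<integral>y. ?f y \<xi> \<partial>lborel) \<partial>lborel)"
      unfolding A_def
    proof (rule Bochner_Integration.integral_cong)
      fix \<xi>
      have fe: "?f y \<xi> = cis (\<xi> \<bullet> x) * gauss (e n *\<^sub>R \<xi>) * (cis (- 1 * (y \<bullet> \<xi>)) * h y)" for y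
      proof -
        have "cis (\<xi> \<bullet> (x - y)) = cis (\<xi> \<bullet> x) * cis (- 1 * (y \<bullet> \<xi>))"
          by (simp add: cis_mult inner_diff_right inner_commute[of y])
        then show ?thesis by (simp only: mult_ac)
      qed
      show "cis (\<xi> \<bullet> x) * F \<xi> * gauss (e n *\<^sub>R \<xi>) = (\<integral>y. ?f y \<xi> \<partial>lborel)"
        unfolding fe integral_mult_right_zero F_def ft_def by (simp only: mult_ac)
    qed simp
    also have "\<dots> = (\<integral>y. (\<integral>\<xi>. ?f y \<xi> \<partial>lborel) \<partial>lborel)"
    proof (rule lborel_pair.Fubini_integral)
      show "integrable (lborel \<Otimes>\<^sub>M lborel) (\<lambda>(y, \<xi>). ?f y \<xi>)"
        by (rule integrable_pair_bound[OF schwartz_integrable[OF assms] ge, where A=1]) (auto simp: norm_mult)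
    qed
    also have "\<dots> = (\<integral>y. h y * (of_real (sqrt (2 * pi) ^ CARD('n)) * gauss ((x - y) /\<^sub>R e n) /\<^sub>R e n ^ CARD('n)) \<partial>lborel)"
    proof (rule Bochner_Integration.integral_cong)
      fix y
      have "(\<integral>\<xi>. cis (\<xi> \<bullet> (x - y)) * gauss (e n *\<^sub>R \<xi>) \<partial>lborel) =
         \<bar>inverse (e n)\<bar> ^ CARD('n) *\<^sub>R (\<integral>\<xi>. cis ((0 + inverse (e n) *\<^sub>R \<xi>) \<bullet> (x - y)) * gauss (e n *\<^sub>R (0 + inverse (e n) *\<^sub>R \<xi>)) \<partial>lborel)"
        using ep[of n] by (subst integral_affine[where c="inverse (e n)" and t=0]) auto
      also have "\<dots> = inverse (e n) ^ CARD('n) *\<^sub>R (\<integral>\<xi>. cis (\<xi> \<bullet> ((x - y) /\<^sub>R e n)) * gauss \<xi> \<partial>lborel)"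
        using ep[of n] by simp
      also have "\<dots> = inverse (e n) ^ CARD('n) *\<^sub>R (of_real (sqrt (2 * pi) ^ CARD('n)) * gauss ((x - y) /\<^sub>R e n))"
        by (subst gauss_ft(2)) simp
      finally show "(\<integral>\<xi>. ?f y \<xi> \<partial>lborel) =
          h y * (of_real (sqrt (2 * pi) ^ CARD('n)) * gauss ((x - y) /\<^sub>R e n) /\<^sub>R e n ^ CARD('n))"
        by (simp add: mult.assoc mult.left_commute[of _ "h y"] power_inverse)
    qed simp
    \<comment> \<open>Substitute y = x + e z. The Jacobian cancels the factor e^(-d), and the
      argument of the Gaussian becomes -z, where evenness applies.\<close>
    also have "\<dots> = e n ^ CARD('n) *\<^sub>R (\<integral>z. h (x + e n *\<^sub>R z) * (of_real (sqrt (2 * pi) ^ CARD('n)) * gauss ((x - (x + e n *\<^sub>R z)) /\<^sub>R e n) /\<^sub>R e n ^ CARD('n)) \<partial>lborel)"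
      using ep[of n] by (subst integral_affine[where c="e n" and t=x]) auto
    also have "\<dots> = (\<integral>z. of_real (sqrt (2 * pi) ^ CARD('n)) * (gauss z * h (x + e n *\<^sub>R z)) \<partial>lborel)"
      using ep[of n] by (subst integral_scaleR_right[symmetric]) (simp add: gauss_def mult_ac)
    finally show ?thesis by simp
  qed
  have "(\<lambda>n. \<integral>z. gauss z * h (x + e n *\<^sub>R z) \<partial>lborel) \<longlonglongrightarrow> (\<integral>z. gauss (z :: real^'n) \<partial>lborel) * h x"
    using B hc e0 by (intro approximate_identity gauss_integral) auto
  \<comment> \<open>One factor sqrt(2 pi)^d comes from the transform of the Gaussian, the other from
    its total mass; together they give the (2 pi)^d of the inversion formula.\<close>
  then have "A \<longlonglongrightarrow> of_real (sqrt (2 * pi) ^ CARD('n)) * (of_real (sqrt (2 * pi) ^ CARD('n)) * h x)"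
    unfolding A by (intro tendsto_mult tendsto_const) (simp add: gauss_integral)
  then have "ft 1 F x = of_real (sqrt (2 * pi) ^ CARD('n)) * (of_real (sqrt (2 * pi) ^ CARD('n)) * h x)"
    using lim1 LIMSEQ_unique by blast
  also have "\<dots> = of_real ((sqrt (2 * pi) * sqrt (2 * pi)) ^ CARD('n)) * h x"
    by (simp only: power_mult_distrib of_real_mult mult.assoc)
  finally show ?thesis by (simp add: F_def)
qed

lemma inv_fourier_fourier:
  assumes "schwartz h"
  shows "inv_fourier (fourier h) = h"
proof
  fix x
  have "(2 * pi) powr (- real CARD('a)) * (2 * pi) ^ CARD('a) = 1"
    unfolding powr_minus by (subst powr_realpow, simp, rule left_inverse, simp)
  then have "complex_of_real ((2 * pi) powr (- real CARD('a))) * (of_real ((2 * pi) ^ CARD('a)) * h x) = h x"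
    by (simp only: mult.assoc[symmetric] of_real_mult[symmetric]) simp
  then show "inv_fourier (fourier h) x = h x"
    by (simp only: inv_fourier_eq_ft fourier_eq_ft ft_inversion[OF assms])
qed

lemma schwartz_inv_fourier: "schwartz \<phi> \<Longrightarrow> schwartz (inv_fourier \<phi>)"
  unfolding inv_fourier_eq_ft by (intro schwartz_cmult ft_schwartz) auto

lemma schwartz_fourier: "schwartz \<phi> \<Longrightarrow> schwartz (fourier \<phi>)"
  unfolding fourier_eq_ft by (intro ft_schwartz) auto

section \<open>Uniqueness of the function representing a distribution\<close>

text \<open>Boxes form an intersection-stable generator of the Borel sets, so a Dynkin argument
  extends the vanishing to all of them. Complements need the integral over the whole space, which is
  zero by exhaustion with growing boxes.\<close>

lemma AE_zero_if_box_integrals_zero: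
  fixes H :: "'a::euclidean_space \<Rightarrow> complex"
  assumes H: "integrable lborel H" and box: "\<And>a b. (LINT x:box a b|lborel. H x) = 0"
  shows "AE x in lborel. H x = 0"
proof (rule sigma_finite_measure.density_zero[OF sigma_finite_lborel H])
  have UN: "integral\<^sup>L lborel H = 0"
  proof -
    have "(\<lambda>n. LINT x:box (- (real n *\<^sub>R One)) (real n *\<^sub>R One)|lborel. H x) \<longlonglongrightarrow> (LINT x:(\<Union>n::nat. box (- (real n *\<^sub>R One)) (real n *\<^sub>R One :: 'a))|lborel. H x)"
      using H by (intro set_integral_cont_up)
         (auto simp: incseq_def subset_box set_integrable_def integrable_mult_indicator)
    then show ?thesis by (simp only: box UN_box_eq_UNIV) (simp add: set_lebesgue_integral_def LIMSEQ_const_iff)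
  qed
  have si: "set_integrable lborel A H" if "A \<in> sets borel" for A
    using H that by (simp add: set_integrable_def integrable_mult_indicator)
  fix A :: "'a set" assume "A \<in> sets lborel"
  then have A: "A \<in> sigma_sets UNIV (range (\<lambda>(a, b). box a b))" by (simp add: borel_eq_box)
  have "Int_stable (range (\<lambda>(a, b). box a b :: 'a set))"
    by (auto simp: Int_stable_def box_Int_box)
  moreover have "range (\<lambda>(a, b). box a b :: 'a set) \<subseteq> Pow UNIV" by auto
  ultimately show "(LINT x:A|lborel. H x) = 0" using A
  proof (induction rule: sigma_sets_induct_disjoint)
    case (basic A)
    then show ?case using box by auto
  next
    case (compl A)
    then have A: "A \<in> sets borel" by (simp add: borel_eq_box)
    have "(LINT x:(A \<union> (UNIV - A))|lborel. H x) = (LINT x:A|lborel. H x) + (LINT x:(UNIV - A)|lborel. H x)"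
      using A by (intro set_integral_Un si) auto
    then show ?case using compl UN by (simp add: set_lebesgue_integral_def)
  next
    case (union F)
    then have F: "F i \<in> sets borel" for i by (auto simp: borel_eq_box)
    have "(LINT x:(\<Union>i. F i)|lborel. H x) = (\<Sum>i. (LINT x:(F i)|lborel. H x))"
      using F union(1) by (intro lebesgue_integral_countable_add si) (auto simp: disjoint_family_on_def)
    then show ?case using union by simp
  qed (simp add: set_lebesgue_integral_def)
qed

text \<open>The excluded set is the boundary of the box, a null set; elsewhere the indicator is
  continuous.\<close>

lemma box_mollification_limit:
  fixes K :: "'a::euclidean_space \<Rightarrow> complex"
  assumes "integrable lborel K" "e \<longlonglongrightarrow> 0" "y \<notin> cbox a b - box a b"
  shows "(\<lambda>n. \<integral>z. K z * indicator (box a b) (y + e n *\<^sub>R z) \<partial>lborel) \<longlonglongrightarrow> (\<integral>z. K z \<partial>lborel) * indicator (box a b) y"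
proof (rule approximate_identity[where B=1])
  have "isCont (indicator (box a b) :: 'a \<Rightarrow> real) y"
    using assms(3) by (auto simp: isCont_indicator frontier_box)
  then have "isCont (\<lambda>x. complex_of_real (indicator (box a b) x)) y"
    by (intro continuous_intros)
  then show "isCont (indicator (box a b) :: 'a \<Rightarrow> complex) y"
    by (simp add: of_real_indicator[abs_def])
qed (use assms in \<open>auto simp: indicator_def\<close>)

text \<open>Mollifying the indicator of a box with \<open>K\<close> gives test functions, so the integral of \<open>h\<close>
  (cut off by a dilate of \<open>K\<close>) over every box vanishes.\<close>

lemma zero_if_test_integrals_zero:
  fixes K :: "real^'n::finite \<Rightarrow> real" and h :: "'n test"
  assumes K: "smooth (\<lambda>x. complex_of_real (K x))" and K0: "\<And>x. 0 \<le> K x"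
    and K1: "\<And>x. (\<forall>i. \<bar>x $ i\<bar> \<le> 1) \<Longrightarrow> K x = 1" and KR: "\<And>x. norm x > R \<Longrightarrow> K x = 0"
    and [measurable]: "h \<in> borel_measurable borel"
    and h: "\<And>\<phi>. schwartz \<phi> \<Longrightarrow> integrable lborel (\<lambda>x. h x * \<phi> x)"
    and h0: "\<And>\<phi>. schwartz \<phi> \<Longrightarrow> (\<integral>x. h x * \<phi> x \<partial>lborel) = 0"
  shows "AE x in lborel. h x = 0"
proof -
  define k where "k x = complex_of_real (K x)" for x
  have ks: "smooth k" using K by (simp add: k_def[abs_def])
  have kR: "norm x > R \<Longrightarrow> k x = 0" for x using KR by (simp add: k_def)
  have kS: "schwartz k" using ks kR by (rule schwartz_compact_support)
  have ki: "integrable lborel k" using kS by (rule schwartz_integrable)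
  have [measurable]: "k \<in> borel_measurable borel" using kS by measurable
  obtain B where "semi 0 k B" using kS schwartz_iff_semi by blast
  then have kB: "norm (k y) \<le> B" for y using semi_bound[of 0 k B y] by simp
  \<comment> \<open>The kernel is not normalised, so its mass has to be divided out at the end. It
    is positive because \<open>K\<close> is nonnegative and equals 1 on a cube.\<close>
  have knz: "(\<integral>x. k x \<partial>lborel) \<noteq> 0"
  proof
    assume "(\<integral>x. k x \<partial>lborel) = 0"
    then have z: "(\<integral>x. K x \<partial>lborel) = 0" unfolding k_def by simp
    have Ki: "integrable lborel K"
      using integrable_norm[OF ki] K0 by (simp add: k_def)
    let ?Q = "box (- One) (One :: real^'n)"
    have "(\<integral>x. indicator ?Q x \<partial>lborel) \<le> (\<integral>x. K x \<partial>lborel)"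
    proof (rule integral_mono)
      show "integrable lborel (indicator ?Q :: _ \<Rightarrow> real)"
        by (intro integrable_real_indicator) (auto simp: emeasure_lborel_box_eq)
      fix x :: "real^'n"
      have "K x = 1" if "x \<in> ?Q"
      proof (rule K1, intro allI)
        fix i
        have "\<forall>b\<in>Basis. - 1 < x \<bullet> b \<and> x \<bullet> b < 1" using that by (simp add: box_def)
        then show "\<bar>x $ i\<bar> \<le> 1" using axis_in_Basis_iff[of i "1::real"]
          by (force simp: inner_axis dest: bspec[of _ _ "axis i 1"])
      qed
      then show "indicator ?Q x \<le> K x" using K0[of x] by (auto simp: indicator_def)
    qed (rule Ki)
    moreover have "measure lborel ?Q > 0"
    proof -
      have "measure lborel ?Q = (\<Prod>b\<in>(Basis :: (real^'n) set). ((One :: real^'n) - (- One)) \<bullet> b)"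
        by (subst measure_lborel_box_eq) auto
      also have "\<dots> = (\<Prod>b\<in>(Basis :: (real^'n) set). 2)"
        by (intro prod.cong refl) (simp only: inner_diff_left inner_minus_left, simp)
      finally show ?thesis by simp
    qed
    ultimately show False using z by simp
  qed
  \<comment> \<open>\<open>h\<close> is known to be integrable only against Schwartz functions,
    whereas the box criterion requires an integrable function; a dilated cutoff makes it
    one.\<close>
  have key: "AE x in lborel. h x * k (c *\<^sub>R x + 0) = 0" if c: "c > 0" for c
  proof -
    define \<theta> where "\<theta> x = k (c *\<^sub>R x + 0)" for x
    have \<theta>s: "smooth \<theta>" unfolding \<theta>_def[abs_def] by (rule smooth_affine[OF ks])
    have \<theta>R: "\<theta> x = 0" if "norm x > R / c" for x
      unfolding \<theta>_def using that c by (intro kR) (auto simp: field_simps)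
    have \<theta>S: "schwartz \<theta>" using \<theta>s \<theta>R by (rule schwartz_compact_support)
    define H where "H x = h x * \<theta> x" for x
    have [measurable]: "\<theta> \<in> borel_measurable borel" using \<theta>S by measurable
    have [measurable]: "H \<in> borel_measurable borel" unfolding H_def[abs_def] by measurable
    have Hi: "integrable lborel H" using h[OF \<theta>S] by (simp add: H_def[abs_def])
    have "AE x in lborel. H x = 0"
    proof (rule AE_zero_if_box_integrals_zero[OF Hi])
      fix a b :: "real^'n"
      define I where "I = (indicator (box a b) :: real^'n \<Rightarrow> complex)"
      have [measurable]: "I \<in> borel_measurable borel" by (simp add: I_def)
      have Ii: "integrable lborel I"
      proof -
        have "integrable lborel (indicator (box a b) :: _ \<Rightarrow> real)"
          by (intro integrable_real_indicator) (auto simp: emeasure_lborel_box_eq)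
        then have "integrable lborel (\<lambda>x. complex_of_real (indicator (box a b) x))"
          by (rule integrable_of_real)
        then show ?thesis by (simp add: I_def of_real_indicator)
      qed
      have I1: "norm (I x) \<le> 1" for x by (simp add: I_def indicator_def)
      define e where "e n = inverse (real (Suc n))" for n
      have e0: "e \<longlonglongrightarrow> 0" unfolding e_def by (rule LIMSEQ_inverse_real_of_nat)
      have ep: "0 < e n" for n by (simp add: e_def)
      define bb where "bb n y = (\<integral>z. k z * I (y + e n *\<^sub>R z) \<partial>lborel)" for n y
      have zero: "(\<integral>y. H y * bb n y \<partial>lborel) = 0" for n
      proof -
        let ?f = "\<lambda>x y. I x * (H y * k (inverse (e n) *\<^sub>R (x - y)))"
        have fi: "integrable (lborel \<Otimes>\<^sub>M lborel) (\<lambda>(x, y). ?f x y)"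
        proof (rule integrable_pair_bound[OF Ii Hi, where A=B])
          fix x y
          show "norm (case (x, y) of (x, y) \<Rightarrow> ?f x y) \<le> B * norm (I x) * norm (H y)"
            using mult_left_mono[OF kB[of "inverse (e n) *\<^sub>R (x - y)"], of "norm (I x) * norm (H y)"]
            by (simp add: norm_mult mult_ac)
        qed measurable
        have "(\<integral>y. H y * bb n y \<partial>lborel) = (\<integral>y. (\<integral>x. ?f x y \<partial>lborel) /\<^sub>R e n ^ CARD('n) \<partial>lborel)"
        proof (rule Bochner_Integration.integral_cong)
          fix y
          have "(\<integral>x. I x * k (inverse (e n) *\<^sub>R (x - y)) \<partial>lborel) = e n ^ CARD('n) *\<^sub>R bb n y"
            unfolding bb_def using ep[of n]
            by (subst integral_affine[where c="e n" and t=y]) (auto simp: mult.commute)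
          moreover have "(\<integral>x. ?f x y \<partial>lborel) = H y * (\<integral>x. I x * k (inverse (e n) *\<^sub>R (x - y)) \<partial>lborel)"
            by (subst mult.left_commute) simp
          ultimately show "H y * bb n y = (\<integral>x. ?f x y \<partial>lborel) /\<^sub>R e n ^ CARD('n)"
            using ep[of n] by simp
        qed simp
        also have "\<dots> = (\<integral>y. (\<integral>x. ?f x y \<partial>lborel) \<partial>lborel) /\<^sub>R e n ^ CARD('n)"
          by (rule integral_scaleR_right)
        also have "(\<integral>y. (\<integral>x. ?f x y \<partial>lborel) \<partial>lborel) = (\<integral>x. (\<integral>y. ?f x y \<partial>lborel) \<partial>lborel)"
          by (rule lborel_pair.Fubini_integral[OF fi])
        \<comment> \<open>For fixed x the inner integral tests \<open>h\<close> with the function y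
          \<mapsto> \<theta>(y) k((x - y)/e), which is smooth with compact support.\<close>
        also have "\<dots> = (\<integral>x. 0 \<partial>(lborel :: (real^'n) measure))"
        proof (rule Bochner_Integration.integral_cong)
          fix x
          have "smooth (\<lambda>y. k (- inverse (e n) *\<^sub>R y + inverse (e n) *\<^sub>R x))" by (rule smooth_affine[OF ks])
          then have "smooth (\<lambda>y. \<theta> y * k (- inverse (e n) *\<^sub>R y + inverse (e n) *\<^sub>R x))"
            by (rule smooth_mult[OF \<theta>s])
          then have "schwartz (\<lambda>y. \<theta> y * k (- inverse (e n) *\<^sub>R y + inverse (e n) *\<^sub>R x))"
            by (rule schwartz_compact_support) (use \<theta>R in auto)
          then have "(\<integral>y. h y * (\<theta> y * k (- inverse (e n) *\<^sub>R y + inverse (e n) *\<^sub>R x)) \<partial>lborel) = 0"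
            by (rule h0)
          then have "(\<integral>y. H y * k (inverse (e n) *\<^sub>R (x - y)) \<partial>lborel) = 0"
            by (simp add: H_def algebra_simps)
          then show "(\<integral>y. ?f x y \<partial>lborel) = 0" by simp
        qed simp
        finally show ?thesis by simp
      qed
      have bbB: "norm (bb n y) \<le> (\<integral>z. norm (k z) \<partial>lborel)" for n y
        unfolding bb_def
      proof (rule norm_integral_le_integral)
        show b: "norm (k z * I (y + e n *\<^sub>R z)) \<le> norm (k z)" for z
          using I1[of "y + e n *\<^sub>R z"] by (simp add: norm_mult mult_left_le)
        show "integrable lborel (\<lambda>z. k z * I (y + e n *\<^sub>R z))"
          by (rule Bochner_Integration.integrable_bound[OF ki]) (auto intro!: b)
      qed (use ki in simp)
      have "(\<lambda>n. \<integral>y. H y * bb n y \<partial>lborel) \<longlonglongrightarrow> (\<integral>y. H y * ((\<integral>z. k z \<partial>lborel) * I y) \<partial>lborel)"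
      proof (rule integral_dominated_convergence[where w="\<lambda>y. norm (H y) * (\<integral>z. norm (k z) \<partial>lborel)"])
        \<comment> \<open>Negligibility refers to the completed Lebesgue measure; the set is Borel,
          so it is null for \<open>lborel\<close> as well.\<close>
        have "cbox a b - box a b \<in> null_sets lborel"
          using negligible_frontier_interval[of a b]
          by (subst null_sets_completion_iff[symmetric]) (auto simp: negligible_iff_null_sets)
        then have "AE y in lborel. y \<notin> cbox a b - box a b" by (rule AE_not_in)
        then show "AE y in lborel. (\<lambda>n. H y * bb n y) \<longlonglongrightarrow> H y * ((\<integral>z. k z \<partial>lborel) * I y)"
        proof eventually_elim
          case (elim y)
          then show ?case
            using box_mollification_limit[OF ki e0 elim] by (intro tendsto_mult tendsto_const) (simp add: bb_def I_def)
        qed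
        show "AE y in lborel. norm (H y * bb n y) \<le> norm (H y) * (\<integral>z. norm (k z) \<partial>lborel)" for n
          using bbB by (auto simp: norm_mult intro!: mult_left_mono)
        show "(\<lambda>y. H y * bb n y) \<in> borel_measurable lborel" for n
          unfolding bb_def by measurable
      qed (use Hi in auto)
      then have "(\<integral>y. H y * ((\<integral>z. k z \<partial>lborel) * I y) \<partial>lborel) = 0"
        unfolding zero by (simp add: LIMSEQ_const_iff)
      moreover have "H y * ((\<integral>z. k z \<partial>lborel) * I y) = (\<integral>z. k z \<partial>lborel) * (indicator (box a b) y *\<^sub>R H y)" for y
        by (simp add: I_def indicator_def)
      ultimately have "(\<integral>z. k z \<partial>lborel) * (\<integral>y. indicator (box a b) y *\<^sub>R H y \<partial>lborel) = 0"
        by (simp only: integral_mult_right_zero)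
      then show "(LINT x:box a b|lborel. H x) = 0"
        using knz by (simp add: set_lebesgue_integral_def)
    qed
    then show ?thesis by (simp add: H_def \<theta>_def)
  qed
  \<comment> \<open>Countably many dilations suffice, so the exceptional null sets can be united. At
    a given point the cutoff is 1 as soon as n is at least the norm.\<close>
  have "AE x in lborel. \<forall>n. h x * k (inverse (real (Suc n)) *\<^sub>R x + 0) = 0"
    unfolding AE_all_countable by (intro allI key) simp
  then show ?thesis
  proof eventually_elim
    case (elim x)
    obtain n where n: "norm x \<le> real n" using real_arch_simple by blast
    have "k (inverse (real (Suc n)) *\<^sub>R x + 0) = 1"
      unfolding k_def
    proof (subst K1, safe)
      fix i
      have "\<bar>x $ i\<bar> \<le> real (Suc n)" using n component_le_norm_cart[of x i] by simp
      then show "\<bar>(inverse (real (Suc n)) *\<^sub>R x + 0) $ i\<bar> \<le> 1" by (simp add: abs_mult field_simps)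
    qed simp
    with elim[rule_format, of n] show ?case by simp
  qed
qed

lemma admissible_iso_zero:
  fixes \<psi>0 :: "real^'n::finite \<Rightarrow> real"
  assumes "admissible_iso \<psi>0" "norm x > 3 / 2 * real CARD('n)"
  shows "\<psi>0 x = 0"
proof -
  have "\<exists>i. \<bar>x $ i\<bar> \<ge> 3 / 2"
  proof (rule ccontr)
    assume "\<not> ?thesis"
    then have "(\<Sum>i\<in>UNIV. \<bar>x $ i\<bar>) \<le> (\<Sum>i\<in>(UNIV::'n set). 3 / 2)"
      by (intro sum_mono) (auto simp: not_le less_imp_le)
    then show False using norm_le_l1_cart[of x] assms(2) by simp
  qed
  then show ?thesis using assms(1) by (simp add: admissible_iso_def)
qed

lemma represents_unique:
  fixes \<psi>0 :: "real^'n::finite \<Rightarrow> real" and g g' :: "'n test"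
  assumes \<psi>: "admissible_iso \<psi>0" and g: "represents g T" and g': "represents g' T"
  shows "AE x in lborel. g x = g' x"
proof -
  have [measurable]: "g \<in> borel_measurable borel" "g' \<in> borel_measurable borel"
    using g g' by (auto simp: represents_def)
  have "AE x in lborel. g x - g' x = 0"
    \<comment> \<open>\<open>\<psi>0\<close> may change sign, so its square serves as the mollifier.\<close>
  proof (rule zero_if_test_integrals_zero[where K="\<lambda>x. (\<psi>0 x)\<^sup>2" and R="3 / 2 * real CARD('n)"])
    have "smooth (\<lambda>x. complex_of_real (\<psi>0 x) * complex_of_real (\<psi>0 x))"
      using \<psi> by (intro smooth_mult) (auto simp: admissible_iso_def)
    then show "smooth (\<lambda>x. complex_of_real ((\<psi>0 x)\<^sup>2))" by (simp add: power2_eq_square)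
    show "(\<psi>0 x)\<^sup>2 = 1" if "\<forall>i. \<bar>x $ i\<bar> \<le> 1" for x using \<psi> that by (simp add: admissible_iso_def)
    show "(\<psi>0 x)\<^sup>2 = 0" if "norm x > 3 / 2 * real CARD('n)" for x
      using admissible_iso_zero[OF \<psi> that] by simp
    fix \<phi> :: "'n test" assume \<phi>: "schwartz \<phi>"
    have i: "integrable lborel (\<lambda>x. g x * \<phi> x)" "integrable lborel (\<lambda>x. g' x * \<phi> x)"
      and e: "(\<integral>x. g x * \<phi> x \<partial>lborel) = (\<integral>x. g' x * \<phi> x \<partial>lborel)"
      using g g' \<phi> by (auto simp: represents_def)
    show "integrable lborel (\<lambda>x. (g x - g' x) * \<phi> x)" "(\<integral>x. (g x - g' x) * \<phi> x \<partial>lborel) = 0"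
      using i e by (auto simp: left_diff_distrib)
  qed auto
  then show ?thesis by simp
qed

section \<open>Quasi-norms of distributions under modulation\<close>

lemma Lp_qnorm_cong_AE:
  assumes "g \<in> borel_measurable lborel" "g' \<in> borel_measurable lborel"
    and "AE x in lborel. norm (g x) = norm (g' x)"
  shows "Lp_qnorm p g = Lp_qnorm p g'"
proof -
  have [measurable]: "g \<in> borel_measurable borel" "g' \<in> borel_measurable borel" using assms by auto
  have "esssup lborel (\<lambda>x. ennreal (norm (g x))) = esssup lborel (\<lambda>x. ennreal (norm (g' x)))"
    using assms(3) by (intro esssup_AE_cong) auto
  moreover have "(\<integral>\<^sup>+x. epow (ennreal (norm (g x))) r \<partial>lborel) = (\<integral>\<^sup>+x. epow (ennreal (norm (g' x))) r \<partial>lborel)" for r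
    using assms(3) by (intro nn_integral_cong_AE) auto
  ultimately show ?thesis by (simp add: Lp_qnorm_def)
qed

text \<open>The choice made in \<open>Lp_qnorm_d\<close> is harmless since representatives agree
  almost everywhere; \<open>\<psi>0\<close> enters as the bump function behind that
  uniqueness.\<close>

lemma Lp_qnorm_d_eq:
  assumes "admissible_iso (\<psi>0 :: real^'n::finite \<Rightarrow> real)" "represents (g :: 'n test) T"
  shows "Lp_qnorm_d p T = Lp_qnorm p g"
proof -
  have s: "represents (SOME g. represents g T) T" by (rule someI[of "\<lambda>g. represents g T", OF assms(2)])
  have "AE x in lborel. norm ((SOME g. represents g T) x) = norm (g x)"
    using represents_unique[OF assms(1) s assms(2)] by (rule AE_mp) auto
  moreover have "(SOME g. represents g T) \<in> borel_measurable lborel" "g \<in> borel_measurable lborel"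
    using s assms(2) unfolding represents_def by auto
  ultimately have "Lp_qnorm p (SOME g. represents g T) = Lp_qnorm p g"
    by (intro Lp_qnorm_cong_AE)
  then show ?thesis using assms(2) by (auto simp: Lp_qnorm_d_def)
qed

lemma represents_modulate:
  assumes "represents g T" "\<And>\<phi>. schwartz \<phi> \<Longrightarrow> T' \<phi> = T (\<lambda>x. cis (a \<bullet> x) * \<phi> x)"
  shows "represents (\<lambda>x. g x * cis (a \<bullet> x)) T'"
proof -
  have [measurable]: "g \<in> borel_measurable borel" using assms by (auto simp: represents_def)
  have "integrable lborel (\<lambda>x. g x * cis (a \<bullet> x) * \<phi> x) \<and> T' \<phi> = (\<integral>x. g x * cis (a \<bullet> x) * \<phi> x \<partial>lborel)"
    if "schwartz \<phi>" for \<phi>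
    using assms(1) schwartz_cis[OF that, of a] assms(2)[OF that]
    by (simp add: represents_def mult.assoc)
  then show ?thesis by (simp add: represents_def)
qed

text \<open>\<open>Lp_qnorm_d\<close> is \<open>top\<close> when there is no representing function,
  so representability must be transferred both ways; modulating by \<open>- a\<close> undoes the
  modulation by \<open>a\<close>. The relation is assumed on Schwartz functions because a functional
  of type \<open>distr\<close> is also defined on functions that are irrelevant here.\<close>

lemma Lp_qnorm_d_modulate:
  assumes \<psi>: "admissible_iso (\<psi>0 :: real^'n::finite \<Rightarrow> real)"
    and T': "\<And>\<phi> :: 'n test. schwartz \<phi> \<Longrightarrow> T' \<phi> = T (\<lambda>x. cis (a \<bullet> x) * \<phi> x)"
  shows "Lp_qnorm_d p T' = Lp_qnorm_d p T"
proof (cases "\<exists>g. represents g T")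
  case True
  then obtain g where g: "represents g T" by blast
  then have [measurable]: "g \<in> borel_measurable borel" by (auto simp: represents_def)
  have "represents (\<lambda>x. g x * cis (a \<bullet> x)) T'" using g T' by (rule represents_modulate)
  then have "Lp_qnorm_d p T' = Lp_qnorm p (\<lambda>x. g x * cis (a \<bullet> x))" by (rule Lp_qnorm_d_eq[OF \<psi>])
  also have "\<dots> = Lp_qnorm p g" by (rule Lp_qnorm_cong_AE) (auto simp: norm_mult)
  also have "\<dots> = Lp_qnorm_d p T" using Lp_qnorm_d_eq[OF \<psi> g] by simp
  finally show ?thesis .
next
  case False
  have "\<not> represents g T'" for g
  proof
    assume g: "represents g T'"
    have "T \<phi> = T' (\<lambda>x. cis ((- a) \<bullet> x) * \<phi> x)" if "schwartz \<phi>" for \<phi>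
      using T'[OF schwartz_cis[OF that, of "- a"]] by (simp add: cis_mult flip: mult.assoc)
    with g have "represents (\<lambda>x. g x * cis ((- a) \<bullet> x)) T" by (rule represents_modulate)
    with False show False by blast
  qed
  with False show ?thesis by (simp add: Lp_qnorm_d_def)
qed

section \<open>Sequence quasi-norms under reindexing\<close>

lemma epow_zero [simp]: "epow 0 r = 0"
  by (simp add: epow_def)

lemma Lp_qnorm_d_zero:
  assumes \<psi>: "admissible_iso (\<psi>0 :: real^'n::finite \<Rightarrow> real)"
    and T: "\<And>\<phi> :: 'n test. schwartz \<phi> \<Longrightarrow> T \<phi> = 0"
  shows "Lp_qnorm_d p T = 0"
proof -
  have "represents (\<lambda>x. 0) T" using T by (simp add: represents_def)
  then have "Lp_qnorm_d p T = Lp_qnorm p (\<lambda>x :: real^'n. 0)" by (rule Lp_qnorm_d_eq[OF \<psi>])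
  also have "\<dots> = 0"
    using esssup_I[of "\<lambda>x :: real^'n. 0 :: ennreal" lborel 0] by (simp add: Lp_qnorm_def)
  finally show ?thesis .
qed

lemma epow_cmult:
  assumes "c > 0" "r > 0"
  shows "epow (ennreal c * x) r = ennreal (c powr r) * epow x r"
proof (cases "x = top")
  case True
  with assms show ?thesis by (simp add: epow_def ennreal_mult_top)
next
  case False
  then have "ennreal c * x \<noteq> top" by (simp add: ennreal_mult_eq_top_iff)
  with False assms show ?thesis
    by (simp add: epow_def enn2real_mult powr_mult ennreal_mult)
qed

text \<open>Arbitrary index types cover both the shift by 4 of the isotropic index and the diagonal
  embedding into multi-indices. Entries off the range vanish and contribute nothing to either the
  sum or the supremum.\<close>

lemma lq_qnorm_reindex:
  fixes a :: "'j \<Rightarrow> ennreal" and b :: "'i \<Rightarrow> ennreal"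
  assumes inj: "inj \<iota>" and b: "\<And>j. b (\<iota> j) = ennreal c * a j" and b0: "\<And>k. k \<notin> range \<iota> \<Longrightarrow> b k = 0"
    and c: "c > 0" and q: "q > 0"
  shows "lq_qnorm q b = ennreal c * lq_qnorm q a"
proof (cases "q = top")
  case True
  have "(SUP k. b k) = (SUP j. b (\<iota> j))"
  proof (rule antisym)
    show "(SUP k. b k) \<le> (SUP j. b (\<iota> j))"
    proof (rule SUP_least)
      fix k show "b k \<le> (SUP j. b (\<iota> j))"
        using b0[of k] by (cases "k \<in> range \<iota>") (auto intro: SUP_upper)
    qed
  qed (auto intro!: SUP_least SUP_upper)
  also have "\<dots> = ennreal c * (SUP j. a j)" by (simp add: b SUP_mult_left_ennreal)
  finally show ?thesis using True by (simp add: lq_qnorm_def)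
next
  case False
  define r where "r = enn2real q"
  have r: "r > 0" using False q by (simp add: r_def enn2real_positive_iff less_top)
  have "(\<integral>\<^sup>+k. epow (b k) r \<partial>count_space UNIV) = (\<integral>\<^sup>+k. epow (b k) r \<partial>count_space (range \<iota>))"
    by (rule nn_integral_count_space_eq) (auto simp: b0)
  also have "\<dots> = (\<integral>\<^sup>+j. epow (b (\<iota> j)) r \<partial>count_space UNIV)"
    using inj by (intro nn_integral_bij_count_space[symmetric]) (simp add: bij_betw_def)
  also have "\<dots> = ennreal (c powr r) * (\<integral>\<^sup>+j. epow (a j) r \<partial>count_space UNIV)"
    using c r by (simp add: b epow_cmult nn_integral_cmult)
  finally have "epow (\<integral>\<^sup>+k. epow (b k) r \<partial>count_space UNIV) (1 / r) =
      ennreal ((c powr r) powr (1 / r)) * epow (\<integral>\<^sup>+j. epow (a j) r \<partial>count_space UNIV) (1 / r)"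
    using c r by (simp add: epow_cmult)
  then show ?thesis using False c r by (simp add: lq_qnorm_def r_def powr_powr)
qed

section \<open>Dyadic multipliers on translated frequency cubes\<close>

lemma two_powr_minus: "(2::real) powr (- real k) = 1 / 2 ^ k" "(2::real) powr (- real k + 1) = 2 / 2 ^ k"
  by (simp_all only: powr_add powr_minus powr_realpow zero_less_numeral powr_one) (simp_all add: divide_inverse)

lemma psi_dyadic: "psi \<psi>0 j x = (if j = 0 then \<psi>0 x else \<psi>0 ((1 / 2 ^ j) *\<^sub>R x) - \<psi>0 ((2 / 2 ^ j) *\<^sub>R x))"
  by (simp only: psi_def two_powr_minus)

lemma phi1_dyadic: "phi1 \<phi>0 j s = (if j = 0 then \<phi>0 s else \<phi>0 ((1 / 2 ^ j) * s) - \<phi>0 ((2 / 2 ^ j) * s))"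
  by (simp only: phi1_def two_powr_minus)

lemma psi_nonzero_bound:
  assumes "admissible_iso \<psi>0" "psi \<psi>0 j x \<noteq> 0"
  shows "\<bar>x $ i\<bar> < 3 / 2 * 2 ^ j"
proof (rule ccontr)
  assume "\<not> ?thesis"
  then have i: "3 / 2 * 2 ^ j \<le> \<bar>x $ i\<bar>" by simp
  have "3 / 2 \<le> \<bar>((1 / 2 ^ j) *\<^sub>R x) $ i\<bar>" "3 / 2 \<le> \<bar>((2 / 2 ^ j) *\<^sub>R x) $ i\<bar>"
    using i by (auto simp: abs_mult field_simps)
  then have "\<psi>0 ((1 / 2 ^ j) *\<^sub>R x) = 0" "\<psi>0 ((2 / 2 ^ j) *\<^sub>R x) = 0"
    using assms(1) unfolding admissible_iso_def by blast+
  then show False using assms(2) by (auto simp: psi_dyadic split: if_splits)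
qed

text \<open>Translation by \<open>14 * 2 ^ j\<close> in each coordinate moves the frequencies \<open>\<bar>\<xi> $ i\<bar> < 3/2 * 2 ^ j\<close> of
  the \<open>j\<close>-th block into the cube \<open>12 * 2 ^ j < \<xi> $ i < 16 * 2 ^ j\<close>. There the isotropic multiplier of
  index \<open>j + 4\<close> and the mixed one of index \<open>(j + 4, \<dots>, j + 4)\<close> equal 1 and all others vanish.\<close>

definition freq_shift :: "nat \<Rightarrow> real^'n::finite" where
  "freq_shift j = (\<chi> i. 14 * 2 ^ j)"

text \<open>A multiplier of positive index is a difference of two cutoffs, dilated by 1/2^k and
  2/2^k. In case \<open>low\<close> both cutoffs are 0; in case \<open>high\<close> both are 1 and
  cancel, where \<open>k > 0\<close> excludes the undifferenced index 0. The bounds are tight: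
  equality occurs at k = j+3 and at k = j+5.\<close>

lemma dyadic_cases:
  fixes k j :: nat
  obtains (eq) "k = j + 4"
  | (low) "k \<noteq> j + 4" "(3::real) / 2 \<le> (1 / 2 ^ k) * (12 * 2 ^ j)" "(3::real) / 2 \<le> (2 / 2 ^ k) * (12 * 2 ^ j)"
  | (high) "k \<noteq> j + 4" "k > 0" "(1 / 2 ^ k) * (16 * 2 ^ j) \<le> (1::real)" "(2 / 2 ^ k) * (16 * 2 ^ j) \<le> (1::real)"
proof -
  have pos: "(0::real) < 2 ^ k" "(0::real) < 2 ^ j" by simp_all
  consider "k = j + 4" | "k \<le> j + 3" | "k \<ge> j + 5" by linarith
  then show ?thesis
  proof cases
    case 2
    then have "(2::real) ^ k \<le> 2 ^ (j + 3)" by (intro power_increasing) auto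
    also have "\<dots> = 8 * 2 ^ j" by (simp add: power_add)
    finally have "3 / 2 * 2 ^ k \<le> (12::real) * 2 ^ j" "3 / 2 * 2 ^ k \<le> (24::real) * 2 ^ j"
      using pos by linarith+
    then show ?thesis using that(2) 2 pos(1) by (simp add: pos_le_divide_eq)
  next
    case 3
    then have "(2::real) ^ (j + 5) \<le> 2 ^ k" by (intro power_increasing) auto
    moreover have "(2::real) ^ (j + 5) = 32 * 2 ^ j" by (simp add: power_add)
    ultimately have "(16::real) * 2 ^ j \<le> 2 ^ k" "(32::real) * 2 ^ j \<le> 2 ^ k"
      using pos by linarith+
    then show ?thesis using that(3) 3 pos(1) by (simp add: pos_divide_le_eq)
  qed (use that in auto)
qed

lemma psi_shift:
  fixes x :: "real^'n::finite"
  assumes \<psi>: "admissible_iso \<psi>0" and x: "psi \<psi>0 j x \<noteq> 0"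
  shows "psi \<psi>0 k (x + freq_shift j) = (if k = j + 4 then 1 else 0)"
proof -
  define y where "y = x + freq_shift j"
  have y: "12 * 2 ^ j < y $ i" "y $ i < 16 * 2 ^ j" for i
    using psi_nonzero_bound[OF \<psi> x, of i] by (auto simp: y_def freq_shift_def)
  have ypos: "0 < y $ i" for i
    using y(1)[of i] by (rule less_trans[rotated]) simp
  have one: "\<psi>0 (c *\<^sub>R y) = 1" if "0 \<le> c" "c * (16 * 2 ^ j) \<le> 1" for c
  proof -
    have "\<bar>(c *\<^sub>R y) $ i\<bar> \<le> 1" for i
      using that ypos[of i] mult_left_mono[OF less_imp_le[OF y(2)[of i]] that(1)] by (simp add: abs_mult)
    then show ?thesis using \<psi> by (simp add: admissible_iso_def)
  qed
  have zero: "\<psi>0 (c *\<^sub>R y) = 0" if "0 \<le> c" "3 / 2 \<le> c * (12 * 2 ^ j)" for c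
  proof -
    have "3 / 2 \<le> \<bar>(c *\<^sub>R y) $ i\<bar>" for i
      using that ypos[of i] mult_left_mono[OF less_imp_le[OF y(1)[of i]] that(1)] by (simp add: abs_mult)
    then show ?thesis using \<psi> by (simp add: admissible_iso_def)
  qed
  show ?thesis
    unfolding y_def[symmetric]
  proof (cases k j rule: dyadic_cases)
    case eq
    \<comment> \<open>At k = j+4 the extreme values are 16/16 = 1 for the outer cutoff and 2 * 12/16
      = 3/2 for the inner one.\<close>
    have "\<psi>0 ((1 / 2 ^ k) *\<^sub>R y) = 1" by (rule one) (simp_all add: eq power_add)
    moreover have "\<psi>0 ((2 / 2 ^ k) *\<^sub>R y) = 0" by (rule zero) (simp_all add: eq power_add)
    ultimately show "psi \<psi>0 k y = (if k = j + 4 then 1 else 0)" by (simp add: psi_dyadic eq)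
  next
    case low
    have "\<psi>0 ((1 / 2 ^ k) *\<^sub>R y) = 0" "\<psi>0 ((2 / 2 ^ k) *\<^sub>R y) = 0"
      by (rule zero[OF _ low(2)], simp, rule zero[OF _ low(3)], simp)
    then show "psi \<psi>0 k y = (if k = j + 4 then 1 else 0)" using low(1) by (auto simp add: psi_dyadic)
  next
    case high
    have "\<psi>0 ((1 / 2 ^ k) *\<^sub>R y) = 1" "\<psi>0 ((2 / 2 ^ k) *\<^sub>R y) = 1"
      by (rule one[OF _ high(3)], simp, rule one[OF _ high(4)], simp)
    then show "psi \<psi>0 k y = (if k = j + 4 then 1 else 0)" using high(1,2) by (simp add: psi_dyadic)
  qed
qed

lemma phi1_shift:
  assumes \<phi>: "admissible_1d \<phi>0" and y: "12 * 2 ^ j < y" "y < 16 * 2 ^ j"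
  shows "phi1 \<phi>0 k y = (if k = j + 4 then 1 else 0)"
proof -
  have ypos: "0 < y"
    using y(1) by (rule less_trans[rotated]) simp
  have one: "\<phi>0 (c * y) = 1" if "0 < c" "c * (16 * 2 ^ j) \<le> 1" for c
  proof -
    have "\<bar>c * y\<bar> \<le> 1"
      using that mult_pos_pos[OF that(1) ypos] mult_left_mono[OF less_imp_le[OF y(2)], of c] by linarith
    then show ?thesis using \<phi> by (simp add: admissible_1d_def)
  qed
  \<comment> \<open>\<open>admissible_1d\<close> gives 0 only strictly beyond 3/2, while
    \<open>dyadic_cases\<close> is attained with equality. Strictness comes from 12 * 2^j < y, which
    is why \<open>c\<close> is strictly positive here.\<close>
  have zero: "\<phi>0 (c * y) = 0" if "0 < c" "3 / 2 \<le> c * (12 * 2 ^ j)" for c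
  proof -
    have "3 / 2 < \<bar>c * y\<bar>"
      using that mult_strict_left_mono[OF y(1), of c] by linarith
    then show ?thesis using \<phi> by (simp add: admissible_1d_def)
  qed
  show ?thesis
  proof (cases k j rule: dyadic_cases)
    case eq
    have "\<phi>0 ((1 / 2 ^ k) * y) = 1" by (rule one) (simp_all add: eq power_add)
    moreover have "\<phi>0 ((2 / 2 ^ k) * y) = 0" by (rule zero) (simp_all add: eq power_add)
    ultimately show ?thesis by (simp add: phi1_dyadic eq)
  next
    case low
    have "\<phi>0 ((1 / 2 ^ k) * y) = 0" "\<phi>0 ((2 / 2 ^ k) * y) = 0"
      by (rule zero[OF _ low(2)], simp, rule zero[OF _ low(3)], simp)
    then show ?thesis using low(1) by (auto simp add: phi1_dyadic)
  next
    case high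
    have "\<phi>0 ((1 / 2 ^ k) * y) = 1" "\<phi>0 ((2 / 2 ^ k) * y) = 1"
      by (rule one[OF _ high(3)], simp, rule one[OF _ high(4)], simp)
    then show ?thesis using high(1,2) by (simp add: phi1_dyadic)
  qed
qed

text \<open>All coordinates of the translated point lie in the same dyadic range, so one index k i
  other than j+4 already annihilates the product.\<close>

lemma phi_mixed_shift:
  fixes x :: "real^'n::finite"
  assumes \<psi>: "admissible_iso \<psi>0" and \<phi>: "admissible_1d \<phi>0" and x: "psi \<psi>0 j x \<noteq> 0"
  shows "phi_mixed \<phi>0 k (x + freq_shift j) = (if k = (\<lambda>_. j + 4) then 1 else 0)"
proof -
  have "12 * 2 ^ j < (x + freq_shift j) $ i" "(x + freq_shift j) $ i < 16 * 2 ^ j" for i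
    using psi_nonzero_bound[OF \<psi> x, of i] by (auto simp: freq_shift_def)
  then have "phi1 \<phi>0 (k i) ((x + freq_shift j) $ i) = (if k i = j + 4 then 1 else 0)" for i
    by (intro phi1_shift[OF \<phi>])
  then show ?thesis by (auto simp: phi_mixed_def fun_eq_iff prod_zero_iff)
qed

section \<open>Smoothness, supports and uniform bounds of the multipliers\<close>

lemma smooth_psi:
  assumes "admissible_iso \<psi>0"
  shows "smooth (\<lambda>x. complex_of_real (psi \<psi>0 j x))"
proof -
  have s: "smooth (\<lambda>x. complex_of_real (\<psi>0 x))" using assms by (simp add: admissible_iso_def)
  have "smooth (\<lambda>x. complex_of_real (\<psi>0 (c *\<^sub>R x)))" for c
    using smooth_affine[OF s, of c 0] by simp
  with s show ?thesis by (cases "j = 0") (auto simp: psi_def smooth_diff)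
qed

text \<open>Converts supports in boxes, possibly with a different side in each direction, into the
  support in a ball that the Schwartz criteria ask for.\<close>

lemma norm_ge_imp_coord_ge:
  fixes x :: "real^'n::finite"
  assumes "norm x > (\<Sum>i\<in>UNIV. r i)"
  shows "\<exists>i. \<bar>x $ i\<bar> > r i"
proof (rule ccontr)
  assume "\<not> ?thesis"
  then have "(\<Sum>i\<in>UNIV. \<bar>x $ i\<bar>) \<le> (\<Sum>i\<in>UNIV. r i)"
    by (intro sum_mono) (auto simp: not_less)
  then show False using norm_le_l1_cart[of x] assms by simp
qed

lemma psi_compact_support:
  assumes "admissible_iso \<psi>0" "norm x > (\<Sum>i\<in>(UNIV :: 'n set). 3 / 2 * 2 ^ j)"
  shows "psi \<psi>0 j (x :: real^'n::finite) = 0"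
proof -
  obtain i where "\<bar>x $ i\<bar> > 3 / 2 * 2 ^ j" using norm_ge_imp_coord_ge[OF assms(2)] by blast
  then show ?thesis using psi_nonzero_bound[OF assms(1), of j x i] by linarith
qed

text \<open>Links iterated \<open>deriv\<close> on the line with iterated partial derivatives. The
  coefficient \<open>c\<close> in the invariant turns into 0 when the direction differs from
  \<open>i\<close>.\<close>

lemma smooth1_coord:
  assumes "smooth1 f"
  shows "smooth (\<lambda>x. complex_of_real (f (x $ i)))"
proof (rule smooth_coinduct[where P="\<lambda>g. \<exists>k c. g = (\<lambda>x. complex_of_real (c * (deriv ^^ k) f (x $ i)))"])
  show "\<exists>k c. (\<lambda>x :: real^'a. complex_of_real (f (x $ i))) = (\<lambda>x. complex_of_real (c * (deriv ^^ k) f (x $ i)))"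
    by (intro exI[of _ 0] exI[of _ 1]) simp
next
  fix g :: "'a test" and l assume "\<exists>k c. g = (\<lambda>x. complex_of_real (c * (deriv ^^ k) f (x $ i)))"
  then obtain k c where g: "g = (\<lambda>x. complex_of_real (c * (deriv ^^ k) f (x $ i)))" by blast
  have d: "((deriv ^^ k) f has_real_derivative (deriv ^^ Suc k) f s) (at s)" for s
    using assms by (simp add: smooth1_def DERIV_deriv_iff_real_differentiable)
  then have "continuous_on UNIV ((deriv ^^ k) f)"
    by (blast intro: continuous_at_imp_continuous_on DERIV_isCont)
  then have "continuous_on UNIV (\<lambda>x :: real^'a. (deriv ^^ k) f (x $ i))"
    by (rule continuous_on_compose2) (auto intro: continuous_intros)
  then show "continuous_on UNIV g"
    unfolding g by (intro continuous_on_of_real continuous_on_mult_left)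
  define \<delta> :: real where "\<delta> = (if i = l then 1 else 0)"
  have "has_partial l g (\<lambda>x. complex_of_real ((c * \<delta>) * (deriv ^^ Suc k) f (x $ i)))"
    unfolding has_partial_def
  proof
    fix x :: "real^'a"
    have "((\<lambda>t. (deriv ^^ k) f (x $ i + t * \<delta>)) has_real_derivative (deriv ^^ Suc k) f (x $ i + 0 * \<delta>) * \<delta>) (at 0)"
      by (rule DERIV_chain2[OF d]) (auto intro!: derivative_eq_intros)
    then have "((\<lambda>t. c * (deriv ^^ k) f (x $ i + t * \<delta>)) has_real_derivative c * ((deriv ^^ Suc k) f (x $ i) * \<delta>)) (at 0)"
      by (intro DERIV_cmult) simp
    then have "((\<lambda>t. complex_of_real (c * (deriv ^^ k) f (x $ i + t * \<delta>))) has_vector_derivative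
        complex_of_real (c * ((deriv ^^ Suc k) f (x $ i) * \<delta>))) (at 0)"
      by (intro has_vector_derivative_of_real) (simp add: has_real_derivative_iff_has_vector_derivative)
    moreover have line: "(x + t *\<^sub>R axis l 1) $ i = x $ i + t * \<delta>" for t
      by (simp add: axis_def \<delta>_def)
    ultimately show "((\<lambda>t. g (x + t *\<^sub>R axis l 1)) has_vector_derivative
        complex_of_real ((c * \<delta>) * (deriv ^^ Suc k) f (x $ i))) (at 0)"
      by (simp only: g line mult_ac)
  qed
  then show "\<exists>g'. (\<exists>k c. g' = (\<lambda>x. complex_of_real (c * (deriv ^^ k) f (x $ i)))) \<and> has_partial l g g'"
    by blast
qed

lemma smooth_phi_mixed:
  fixes k :: "'n::finite \<Rightarrow> nat"
  assumes "admissible_1d \<phi>0"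
  shows "smooth (\<lambda>x. complex_of_real (phi_mixed \<phi>0 k x))"
proof -
  have s: "smooth (\<lambda>x :: real^'n. complex_of_real (\<phi>0 (x $ i)))" for i
    using assms by (intro smooth1_coord) (simp add: admissible_1d_def)
  have sc: "smooth (\<lambda>x :: real^'n. complex_of_real (\<phi>0 (c * x $ i)))" for c i
    using smooth_affine[OF s[of i], of c 0] by simp
  have "smooth (\<lambda>x :: real^'n. complex_of_real (phi1 \<phi>0 m (x $ i)))" for m i
    using s sc by (cases "m = 0") (auto simp: phi1_def smooth_diff)
  then have "smooth (\<lambda>x :: real^'n. \<Prod>i\<in>UNIV. complex_of_real (phi1 \<phi>0 (k i) (x $ i)))"
    by (intro smooth_prod)
  then show ?thesis by (simp add: phi_mixed_def)
qed

lemma phi_mixed_compact_support: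
  assumes \<phi>: "admissible_1d \<phi>0" and x: "norm x > (\<Sum>i\<in>UNIV. 3 / 2 * 2 ^ k i)"
  shows "phi_mixed \<phi>0 k (x :: real^'n::finite) = 0"
proof -
  obtain i where i: "\<bar>x $ i\<bar> > 3 / 2 * 2 ^ k i" using norm_ge_imp_coord_ge[OF x] by blast
  have "3 / 2 < \<bar>(1 / 2 ^ k i) * x $ i\<bar>" "3 / 2 < \<bar>(2 / 2 ^ k i) * x $ i\<bar>"
    using i by (auto simp: abs_mult field_simps)
  then have "\<phi>0 ((1 / 2 ^ k i) * x $ i) = 0" "\<phi>0 ((2 / 2 ^ k i) * x $ i) = 0"
    using \<phi> unfolding admissible_1d_def by blast+
  then have "phi1 \<phi>0 (k i) (x $ i) = 0" by (auto simp: phi1_dyadic)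
  then show ?thesis by (auto simp: phi_mixed_def prod_zero_iff)
qed

text \<open>Uniformity in \<open>j\<close> is the point: for positive \<open>j\<close> both dilation
  factors are at most 1, so the chain rule never enlarges a derivative. The two cutoffs account for
  \<open>2 * A\<close>.\<close>

lemma Dpar_psi_bound:
  fixes \<psi>0 :: "real^'n::finite \<Rightarrow> real"
  assumes \<psi>: "admissible_iso \<psi>0"
  shows "\<exists>A\<ge>0. \<forall>j es x. length es \<le> N \<longrightarrow> norm (Dpar es (\<lambda>x. complex_of_real (psi \<psi>0 j x)) x) \<le> A"
proof -
  define p where "p x = complex_of_real (\<psi>0 x)" for x
  have p: "smooth p" using \<psi> by (simp add: admissible_iso_def p_def[abs_def])
  have "p x = 0" if "norm x > 3 / 2 * real CARD('n)" for x
    using admissible_iso_zero[OF \<psi> that] by (simp add: p_def)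
  from compact_support_Dpar_bound[OF p this] obtain A where A0: "A \<ge> 0"
    and A: "\<And>es x. length es \<le> N \<Longrightarrow> norm (Dpar es p x) \<le> A" by metis
  have "norm (Dpar es (\<lambda>x. complex_of_real (psi \<psi>0 j x)) x) \<le> 2 * A" if es: "length es \<le> N" for j es x
  proof (cases "j = 0")
    case True
    then have "(\<lambda>x. complex_of_real (psi \<psi>0 j x)) = p" by (simp add: psi_def p_def fun_eq_iff)
    then show ?thesis using A[OF es, of x] A0 by simp
  next
    case False
    have e: "(\<lambda>x. complex_of_real (psi \<psi>0 j x)) =
        (\<lambda>x. p ((1 / 2 ^ j) *\<^sub>R x + 0) + (- 1) * p ((2 / 2 ^ j) *\<^sub>R x + 0))"
      using False by (simp add: psi_dyadic p_def fun_eq_iff)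
    have b: "norm (complex_of_real c ^ length es * Dpar es p y) \<le> A" if "0 \<le> c" "c \<le> 1" for c y
    proof -
      have "norm (complex_of_real c ^ length es * Dpar es p y) = c ^ length es * norm (Dpar es p y)"
        using that by (simp add: norm_mult norm_power)
      also have "\<dots> \<le> 1 * A" using that A[OF es] A0 by (intro mult_mono power_le_one) auto
      finally show ?thesis by simp
    qed
    have "(2::real) ^ 1 \<le> 2 ^ j" using False by (intro power_increasing) auto
    then have c: "1 / 2 ^ j \<le> (1::real)" "2 / 2 ^ j \<le> (1::real)" by (auto simp: divide_le_eq)
    have "Dpar es (\<lambda>x. complex_of_real (psi \<psi>0 j x)) x =
        complex_of_real (1 / 2 ^ j) ^ length es * Dpar es p ((1 / 2 ^ j) *\<^sub>R x + 0) +
        (- 1) * (complex_of_real (2 / 2 ^ j) ^ length es * Dpar es p ((2 / 2 ^ j) *\<^sub>R x + 0))"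
      unfolding e
      by (subst Dpar_add[OF smooth_affine[OF p] smooth_mult[OF smooth_const smooth_affine[OF p]]],
          subst Dpar_cmult[OF smooth_affine[OF p]]) (simp only: Dpar_affine[OF p])
    then have "norm (Dpar es (\<lambda>x. complex_of_real (psi \<psi>0 j x)) x) \<le>
        norm (complex_of_real (1 / 2 ^ j) ^ length es * Dpar es p ((1 / 2 ^ j) *\<^sub>R x + 0)) +
        norm ((- 1) * (complex_of_real (2 / 2 ^ j) ^ length es * Dpar es p ((2 / 2 ^ j) *\<^sub>R x + 0)))"
      by (simp only: norm_triangle_ineq)
    also have "\<dots> \<le> A + A"
      unfolding norm_mult[of "- 1"] norm_minus_cancel norm_one mult_1
      using c by (intro add_mono b) auto
    finally show ?thesis by simp
  qed
  then show ?thesis using A0 by (intro exI[of _ "2 * A"]) auto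
qed

section \<open>Convergence and temperedness of the shifted series\<close>

text \<open>For x in the support of the block, y = x + \<open>freq_shift j\<close> has norm at least
  2^j, while |x| is at most a constant times 2^j. Hence the weight at x is controlled by the weight
  at y, where \<open>h\<close> is estimated. Of the \<open>Suc N\<close> powers of decay of
  \<open>h\<close>, \<open>N\<close> pay for this weight and the last gives (1/2)^j.\<close>

lemma shifted_block_semi:
  fixes \<psi>0 :: "real^'n::finite \<Rightarrow> real"
  assumes \<psi>: "admissible_iso \<psi>0"
  shows "\<exists>C\<ge>0. \<forall>h M j. schwartz h \<longrightarrow> semi (Suc N) h M \<longrightarrow>
     semi N (\<lambda>\<xi>. complex_of_real (psi \<psi>0 j \<xi>) * h (\<xi> + freq_shift j)) (C * M * (1 / 2) ^ j)"
proof -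
  obtain A where A0: "A \<ge> 0"
    and A: "\<And>j es x. length es \<le> N \<Longrightarrow> norm (Dpar es (\<lambda>x. complex_of_real (psi \<psi>0 j x)) x) \<le> A"
    using Dpar_psi_bound[OF \<psi>] by metis
  \<comment> \<open>Chosen so that 1 + |x| \<le> \<open>D\<close> (1 + |y|) on the cube: its side
    contributes 3/2 per coordinate.\<close>
  define D where "D = 1 + 3 / 2 * real CARD('n)"
  have D1: "D \<ge> 1" by (simp add: D_def)
  define C where "C = 2 ^ N * A * D ^ N"
  have C0: "C \<ge> 0" using A0 D1 by (simp add: C_def)
  have "(1 + norm x) ^ N * norm (Dpar ds (\<lambda>\<xi>. complex_of_real (psi \<psi>0 j \<xi>) * h (\<xi> + freq_shift j)) x) \<le> C * M * (1 / 2) ^ j"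
    if h: "schwartz h" "semi (Suc N) h M" and ds: "length ds \<le> N" for h M j x ds
  proof -
    have M0: "0 \<le> M" using semi_nonneg h by blast
    show ?thesis
    \<comment> \<open>Derivatives are known to vanish only on open sets, so the boundary of the cube
      goes to the second case.\<close>
    proof (cases "\<exists>i. \<bar>x $ i\<bar> > 3 / 2 * 2 ^ j")
      case True
      then obtain i where i: "\<bar>x $ i\<bar> > 3 / 2 * 2 ^ j" by blast
      have "open {x :: real^'n. 3 / 2 * 2 ^ j < \<bar>x $ i\<bar>}"
        by (intro open_Collect_less continuous_intros)
      moreover have "complex_of_real (psi \<psi>0 j \<xi>) * h (\<xi> + freq_shift j) = 0" if "\<xi> \<in> {x. 3 / 2 * 2 ^ j < \<bar>x $ i\<bar>}" for \<xi>
        using psi_nonzero_bound[OF \<psi>, of j \<xi> i] that by auto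
      ultimately have "Dpar ds (\<lambda>\<xi>. complex_of_real (psi \<psi>0 j \<xi>) * h (\<xi> + freq_shift j)) x = 0"
        using i by (intro Dpar_zero_on_open) auto
      then show ?thesis using C0 M0 by simp
    next
      case False
      then have xi: "\<bar>x $ i\<bar> \<le> 3 / 2 * 2 ^ j" for i by (simp add: not_less)
      define y where "y = x + freq_shift j"
      have hs: "smooth (\<lambda>\<xi>. h (1 *\<^sub>R \<xi> + freq_shift j))" using smooth_affine[OF schwartz_smooth[OF h(1)]] .
      have pos: "0 < 1 + norm y" by (simp add: add_pos_nonneg)
      have "norm (Dpar ds (\<lambda>\<xi>. complex_of_real (psi \<psi>0 j \<xi>) * h (1 *\<^sub>R \<xi> + freq_shift j)) x) \<le>
          2 ^ length ds * A * (M / (1 + norm y) ^ Suc N)"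
      proof (rule Dpar_mult_bound[OF smooth_psi[OF \<psi>] hs A0])
        show "0 \<le> M / (1 + norm y) ^ Suc N" using M0 pos by simp
        fix es :: "'n list" assume es: "length es \<le> length ds"
        then show "norm (Dpar es (\<lambda>x. complex_of_real (psi \<psi>0 j x)) x) \<le> A" using A ds by simp
        have "(1 + norm y) ^ Suc N * norm (Dpar es h y) \<le> M" using h(2) es ds by (simp add: semi_def)
        then have "norm (Dpar es h y) \<le> M / (1 + norm y) ^ Suc N"
          using pos by (simp only: pos_le_divide_eq zero_less_power mult.commute)
        then show "norm (Dpar es (\<lambda>\<xi>. h (1 *\<^sub>R \<xi> + freq_shift j)) x) \<le> M / (1 + norm y) ^ Suc N"
          by (simp only: Dpar_affine[OF schwartz_smooth[OF h(1)]]) (simp add: y_def)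
      qed
      also have "\<dots> \<le> 2 ^ N * A * (M / (1 + norm y) ^ Suc N)"
        using ds A0 M0 pos by (intro mult_right_mono power_increasing) auto
      finally have "(1 + norm x) ^ N * norm (Dpar ds (\<lambda>\<xi>. complex_of_real (psi \<psi>0 j \<xi>) * h (\<xi> + freq_shift j)) x) \<le>
          (1 + norm x) ^ N * (2 ^ N * A * (M / (1 + norm y) ^ Suc N))"
        by (intro mult_left_mono) simp_all
      also have "\<dots> \<le> (D * (1 + norm y)) ^ N * (2 ^ N * A * (M / (1 + norm y) ^ Suc N))"
      proof (intro mult_right_mono power_mono)
        obtain i :: 'n where True by blast
        have "y $ i \<ge> 12 * 2 ^ j" using xi[of i] by (simp add: y_def freq_shift_def abs_le_iff)
        then have "2 ^ j \<le> norm y" using component_le_norm_cart[of y i] zero_le_power[of "2::real" j] by linarith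
        moreover have "norm x \<le> (3 / 2 * real CARD('n)) * 2 ^ j"
        proof -
          have "norm x \<le> (\<Sum>i\<in>(UNIV::'n set). 3 / 2 * 2 ^ j)"
            by (rule order.trans[OF norm_le_l1_cart sum_mono[OF xi]])
          then show ?thesis by (simp add: mult_ac)
        qed
        ultimately have "norm x \<le> (3 / 2 * real CARD('n)) * norm y"
          by (meson mult_left_mono order.trans mult_nonneg_nonneg of_nat_0_le_iff zero_le_divide_iff zero_le_numeral)
        moreover have "D * (1 + norm y) = 1 + norm y + 3 / 2 * real CARD('n) + (3 / 2 * real CARD('n)) * norm y"
          by (simp add: D_def algebra_simps)
        ultimately show "1 + norm x \<le> D * (1 + norm y)"
          using norm_ge_zero[of y] of_nat_0_le_iff[of "CARD('n)"] by linarith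
      qed (use A0 M0 pos in auto)
      also have "\<dots> = C * M * (1 / (1 + norm y))"
      proof -
        have "(D * w) ^ N * (2 ^ N * A * (M / w ^ Suc N)) = C * M * (1 / w)" if "0 < w" for w
          using that by (simp add: C_def power_mult_distrib field_simps)
        then show ?thesis using pos by blast
      qed
      also have "\<dots> \<le> C * M * (1 / 2) ^ j"
      proof (intro mult_left_mono)
        obtain i :: 'n where True by blast
        have "y $ i \<ge> 12 * 2 ^ j" using xi[of i] by (simp add: y_def freq_shift_def abs_le_iff)
        then have "2 ^ j \<le> 1 + norm y" using component_le_norm_cart[of y i] zero_le_power[of "2::real" j] by linarith
        then show "1 / (1 + norm y) \<le> (1 / 2) ^ j" using pos by (simp add: power_one_over frac_le)
      qed (use C0 M0 in auto)
      finally show ?thesis .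
    qed
  qed
  then show ?thesis using C0 unfolding semi_def[of N] by blast
qed

lemma tempered_fourier_bound:
  fixes f :: "('n::finite) distr"
  assumes "tempered f"
  shows "\<exists>N C. 0 \<le> C \<and> (\<forall>h M. schwartz h \<longrightarrow> semi N h M \<longrightarrow> norm (f (fourier h)) \<le> C * M)"
proof -
  obtain N C where f: "\<And>\<phi> M. schwartz \<phi> \<Longrightarrow> semi N \<phi> M \<Longrightarrow> norm (f \<phi>) \<le> C * M"
    using assms unfolding tempered_def semi_def by blast
  obtain N' C' where C': "0 \<le> C'" and F: "\<And>(h :: 'n test) M. schwartz h \<Longrightarrow> semi N' h M \<Longrightarrow> semi N (fourier h) (C' * M)"
    using ft_semi[of "- 1" N] unfolding fourier_eq_ft by force
  have "norm (f (fourier h)) \<le> (\<bar>C\<bar> * C') * M" if h: "schwartz h" "semi N' h M" for h M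
  proof -
    have "norm (f (fourier h)) \<le> C * (C' * M)"
      using F[OF h] h(1) by (intro f schwartz_fourier)
    \<comment> \<open>\<open>tempered\<close> does not fix the sign of its constant, whereas later
      estimates multiply by it.\<close>
    also have "\<dots> \<le> \<bar>C\<bar> * (C' * M)"
      using C' semi_nonneg[OF h(2)] by (intro mult_right_mono) auto
    finally show ?thesis by (simp add: mult.assoc)
  qed
  then show ?thesis using C' by (intro exI[of _ N'] exI[of _ "\<bar>C\<bar> * C'"]) auto
qed

lemma inv_fourier_modulate:
  "inv_fourier (\<lambda>x. cis (a \<bullet> x) * \<phi> x) = (\<lambda>\<xi>. inv_fourier \<phi> (\<xi> + a))"
  unfolding inv_fourier_eq_ft ft_modulate ..

lemma tempered_zero: "tempered f \<Longrightarrow> f (\<lambda>x. 0) = 0"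
proof -
  assume "tempered f"
  moreover have "schwartz (\<lambda>x. 0)"
    by (rule schwartz_compact_support[OF smooth_const, where R=0]) simp
  ultimately have "f (\<lambda>x. 0 * (\<lambda>x. 0) x) = 0 * f (\<lambda>x. 0)"
    unfolding tempered_def by blast
  then show ?thesis by simp
qed

text \<open>The distribution \<open>shifted \<psi>0 f\<close> is \<open>\<Sum>j. exp (\<i> freq_shift j \<bullet> x) f\<^sub>j\<close>, where \<open>f\<^sub>j\<close> are the
  dyadic blocks of \<open>f\<close>.\<close>

definition shifted :: "(real^'n::finite \<Rightarrow> real) \<Rightarrow> 'n distr \<Rightarrow> 'n distr" where
  "shifted \<psi>0 f \<phi> = (\<Sum>j. f (fourier (\<lambda>\<xi>. complex_of_real (psi \<psi>0 j \<xi>) * inv_fourier \<phi> (\<xi> + freq_shift j))))"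

lemma schwartz_shifted_block:
  fixes \<psi>0 :: "real^'n::finite \<Rightarrow> real"
  assumes "admissible_iso \<psi>0" "schwartz h"
  shows "schwartz (\<lambda>\<xi>. complex_of_real (psi \<psi>0 j \<xi>) * h (\<xi> + freq_shift j))"
proof -
  have "smooth (\<lambda>\<xi>. complex_of_real (psi \<psi>0 j \<xi>) * h (1 *\<^sub>R \<xi> + freq_shift j))"
    using assms by (intro smooth_mult smooth_psi smooth_affine schwartz_smooth)
  then show ?thesis
    by (intro schwartz_compact_support[where R="\<Sum>i\<in>(UNIV :: 'n set). 3 / 2 * 2 ^ j"])
       (auto simp: psi_compact_support[OF assms(1)] simp del: sum_constant)
qed

text \<open>Three seminorm estimates are chained: inverse transform, translated block, and f after
  the Fourier transform. \<open>N\<close> and \<open>C\<close> precede \<phi> and \<open>j\<close>,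
  so this one bound serves both summability and temperedness of the sum.\<close>

lemma shifted_terms_bound:
  fixes \<psi>0 :: "real^'n::finite \<Rightarrow> real"
  assumes \<psi>: "admissible_iso \<psi>0" and f: "tempered f"
  shows "\<exists>N C. 0 \<le> C \<and> (\<forall>\<phi> M j. schwartz \<phi> \<longrightarrow> semi N \<phi> M \<longrightarrow>
    norm (f (fourier (\<lambda>\<xi>. complex_of_real (psi \<psi>0 j \<xi>) * inv_fourier \<phi> (\<xi> + freq_shift j)))) \<le> C * M * (1 / 2) ^ j)"
proof -
  obtain N C where C: "0 \<le> C" and fb: "\<And>h M. schwartz h \<Longrightarrow> semi N h M \<Longrightarrow> norm (f (fourier h)) \<le> C * M"
    using tempered_fourier_bound[OF f] by blast
  obtain C1 where C1: "0 \<le> C1" and bb: "\<And>h M j. schwartz h \<Longrightarrow> semi (Suc N) h M \<Longrightarrow>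
     semi N (\<lambda>\<xi>. complex_of_real (psi \<psi>0 j \<xi>) * h (\<xi> + freq_shift j)) (C1 * M * (1 / 2) ^ j)"
    using shifted_block_semi[OF \<psi>] by blast
  obtain N2 C2 where C2: "0 \<le> C2" and Fb: "\<And>\<phi> M. schwartz \<phi> \<Longrightarrow> semi N2 (\<phi> :: 'n test) M \<Longrightarrow> semi (Suc N) (ft 1 \<phi>) (C2 * M)"
    using ft_semi[of 1 "Suc N"] by force
  define c where "c = norm (complex_of_real ((2 * pi) powr (- real CARD('n))))"
  have c: "0 \<le> c" by (simp add: c_def)
  have "norm (f (fourier (\<lambda>\<xi>. complex_of_real (psi \<psi>0 j \<xi>) * inv_fourier \<phi> (\<xi> + freq_shift j)))) \<le>
     (C * (C1 * (c * C2))) * M * (1 / 2) ^ j" if \<phi>: "schwartz \<phi>" "semi N2 \<phi> M" for \<phi> M j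
  proof -
    have "semi (Suc N) (inv_fourier \<phi>) (c * (C2 * M))"
      unfolding inv_fourier_eq_ft c_def using \<phi> by (intro semi_cmult ft_smooth Fb)
    then have "norm (f (fourier (\<lambda>\<xi>. complex_of_real (psi \<psi>0 j \<xi>) * inv_fourier \<phi> (\<xi> + freq_shift j)))) \<le>
       C * (C1 * (c * (C2 * M)) * (1 / 2) ^ j)"
      using \<phi> by (intro fb bb schwartz_shifted_block[OF \<psi>] schwartz_inv_fourier)
    then show ?thesis by (simp only: mult.assoc)
  qed
  then show ?thesis using C C1 C2 c by (intro exI[of _ N2] exI[of _ "C * (C1 * (c * C2))"]) auto
qed

lemma shifted_summable:
  assumes \<psi>: "admissible_iso \<psi>0" and f: "tempered f" and \<phi>: "schwartz \<phi>"
  shows "summable (\<lambda>j. f (fourier (\<lambda>\<xi>. complex_of_real (psi \<psi>0 j \<xi>) * inv_fourier \<phi> (\<xi> + freq_shift j))))"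
proof -
  obtain N C where b: "\<And>M j. semi N \<phi> M \<Longrightarrow>
    norm (f (fourier (\<lambda>\<xi>. complex_of_real (psi \<psi>0 j \<xi>) * inv_fourier \<phi> (\<xi> + freq_shift j)))) \<le> C * M * (1 / 2) ^ j"
    using shifted_terms_bound[OF \<psi> f] \<phi> by blast
  obtain M where M: "semi N \<phi> M" using \<phi> schwartz_iff_semi by blast
  have "summable (\<lambda>j. C * M * (1 / 2 :: real) ^ j)" by (intro summable_mult summable_geometric) simp
  then show ?thesis by (rule summable_comparison_test'[where N=0]) (use b[OF M] in auto)
qed

lemma shifted_tempered:
  fixes \<psi>0 :: "real^'n::finite \<Rightarrow> real"
  assumes \<psi>: "admissible_iso \<psi>0" and f: "tempered f"
  shows "tempered (shifted \<psi>0 f)"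
proof -
  let ?b = "\<lambda>j \<phi> \<xi>. complex_of_real (psi \<psi>0 j \<xi>) * inv_fourier \<phi> (\<xi> + freq_shift j)"
  have f_add: "f (\<lambda>x. g1 x + g2 x) = f g1 + f g2" if "schwartz g1" "schwartz g2" for g1 g2
    using f that by (simp add: tempered_def)
  have f_cmult: "f (\<lambda>x. c * g x) = c * f g" if "schwartz g" for c g
    using f that by (simp add: tempered_def)
  have bS: "schwartz (?b j \<phi>)" if "schwartz \<phi>" for j \<phi>
    using that by (intro schwartz_shifted_block[OF \<psi>] schwartz_inv_fourier)
  have add: "shifted \<psi>0 f (\<lambda>x. g1 x + g2 x) = shifted \<psi>0 f g1 + shifted \<psi>0 f g2"
    if g: "schwartz g1" "schwartz g2" for g1 g2
  proof -
    have "?b j (\<lambda>x. g1 x + g2 x) = (\<lambda>\<xi>. ?b j g1 \<xi> + ?b j g2 \<xi>)" for j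
      unfolding inv_fourier_eq_ft ft_add[OF g] by (simp add: fun_eq_iff algebra_simps)
    then have "f (fourier (?b j (\<lambda>x. g1 x + g2 x))) = f (fourier (?b j g1)) + f (fourier (?b j g2))" for j
      using f_add[OF schwartz_fourier[OF bS[OF g(1)]] schwartz_fourier[OF bS[OF g(2)]], of j j]
        ft_add[OF bS[OF g(1)] bS[OF g(2)], of "- 1" j j] by (simp add: fourier_eq_ft)
    then show ?thesis
      unfolding shifted_def using suminf_add[OF shifted_summable[OF \<psi> f g(1)] shifted_summable[OF \<psi> f g(2)]] by simp
  qed
  have cmult: "shifted \<psi>0 f (\<lambda>x. c * g x) = c * shifted \<psi>0 f g" if g: "schwartz g" for c g
  proof -
    have "?b j (\<lambda>x. c * g x) = (\<lambda>\<xi>. c * ?b j g \<xi>)" for j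
      unfolding inv_fourier_eq_ft ft_cmult by (simp add: fun_eq_iff algebra_simps)
    then have "f (fourier (?b j (\<lambda>x. c * g x))) = c * f (fourier (?b j g))" for j
      using f_cmult[OF schwartz_fourier[OF bS[OF g]], of c j] ft_cmult[of "- 1" c "?b j g"] by (simp add: fourier_eq_ft)
    then show ?thesis
      unfolding shifted_def using suminf_mult[OF shifted_summable[OF \<psi> f g], of c] by simp
  qed
  obtain N C where b: "\<And>\<phi> M j. schwartz \<phi> \<Longrightarrow> semi N \<phi> M \<Longrightarrow> norm (f (fourier (?b j \<phi>))) \<le> C * M * (1 / 2) ^ j"
    using shifted_terms_bound[OF \<psi> f] by blast
  have "norm (shifted \<psi>0 f \<phi>) \<le> (2 * C) * M" if \<phi>: "schwartz \<phi>" "semi N \<phi> M" for \<phi> M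
  proof -
    have s: "(\<lambda>j. C * M * (1 / 2 :: real) ^ j) sums (C * M * 2)"
      using sums_mult[OF geometric_sums[of "1 / 2 :: real"], of "C * M"] by simp
    have sn: "summable (\<lambda>j. norm (f (fourier (?b j \<phi>))))"
      by (rule summable_comparison_test'[OF sums_summable[OF s], where N=0]) (use b[OF \<phi>] in simp)
    have "norm (shifted \<psi>0 f \<phi>) \<le> (\<Sum>j. C * M * (1 / 2 :: real) ^ j)"
      unfolding shifted_def
      by (rule order.trans[OF summable_norm[OF sn] suminf_le[OF b[OF \<phi>] sn sums_summable[OF s]]])
    then show ?thesis using sums_unique[OF s] by (simp add: mult_ac)
  qed
  then have "\<exists>(N::nat) C. \<forall>\<phi> M. schwartz \<phi> \<longrightarrow> semi N \<phi> M \<longrightarrow> norm (shifted \<psi>0 f \<phi>) \<le> C * M" by blast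
  then show ?thesis using add cmult unfolding tempered_def semi_def by blast
qed

section \<open>Blocks of the shifted distribution and comparison of the quasi-norms\<close>

text \<open>Once everything is moved to the test function, Fourier inversion leaves \<open>m\<close>
  evaluated at \<xi> + \<open>freq_shift j\<close> next to \<open>psi \<psi>0 j \<xi>\<close>. There
  \<open>m\<close> is 0 or 1 by hypothesis, so it merely selects terms of the series. It is applied
  with \<open>J\<close> a singleton or empty.\<close>

lemma shifted_block:
  fixes \<psi>0 m :: "real^'n::finite \<Rightarrow> real"
  assumes \<psi>: "admissible_iso \<psi>0" and f: "tempered f" and \<phi>: "schwartz \<phi>"
    and m: "smooth (\<lambda>x. complex_of_real (m x))" "\<And>x. norm x > R \<Longrightarrow> m x = 0"
    and mJ: "\<And>j x. psi \<psi>0 j x \<noteq> 0 \<Longrightarrow> m (x + freq_shift j) = (if j \<in> J then 1 else 0)" and J: "finite J"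
  shows "inv_fourier_d (mult_d m (fourier_d (shifted \<psi>0 f))) \<phi> =
    (\<Sum>j\<in>J. inv_fourier_d (mult_d (psi \<psi>0 j) (fourier_d f)) (\<lambda>x. cis (freq_shift j \<bullet> x) * \<phi> x))"
proof -
  have S: "schwartz (\<lambda>\<xi>. complex_of_real (m \<xi>) * inv_fourier \<phi> \<xi>)"
    using m \<phi> by (intro schwartz_bounded_mult[where R=R] schwartz_inv_fourier) auto
  have t: "(\<lambda>\<xi>. complex_of_real (psi \<psi>0 j \<xi>) * (complex_of_real (m (\<xi> + freq_shift j)) * inv_fourier \<phi> (\<xi> + freq_shift j))) =
     (\<lambda>\<xi>. if j \<in> J then complex_of_real (psi \<psi>0 j \<xi>) * inv_fourier \<phi> (\<xi> + freq_shift j) else 0)" for j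
    using mJ[of j] by (auto simp: fun_eq_iff)
  have "inv_fourier_d (mult_d m (fourier_d (shifted \<psi>0 f))) \<phi> =
     (\<Sum>j. f (fourier (\<lambda>\<xi>. complex_of_real (psi \<psi>0 j \<xi>) * (complex_of_real (m (\<xi> + freq_shift j)) * inv_fourier \<phi> (\<xi> + freq_shift j)))))"
    by (simp add: inv_fourier_d_def mult_d_def fourier_d_def shifted_def inv_fourier_fourier[OF S])
  also have "\<dots> = (\<Sum>j\<in>J. f (fourier (\<lambda>\<xi>. complex_of_real (psi \<psi>0 j \<xi>) * (complex_of_real (m (\<xi> + freq_shift j)) * inv_fourier \<phi> (\<xi> + freq_shift j)))))"
  proof (rule suminf_finite[OF J])
    fix j assume "j \<notin> J"
    then show "f (fourier (\<lambda>\<xi>. complex_of_real (psi \<psi>0 j \<xi>) * (complex_of_real (m (\<xi> + freq_shift j)) * inv_fourier \<phi> (\<xi> + freq_shift j)))) = 0"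
      unfolding t using tempered_zero[OF f] by (simp add: fourier_def[abs_def])
  qed
  also have "\<dots> = (\<Sum>j\<in>J. inv_fourier_d (mult_d (psi \<psi>0 j) (fourier_d f)) (\<lambda>x. cis (freq_shift j \<bullet> x) * \<phi> x))"
    by (intro sum.cong refl) (simp add: t inv_fourier_d_def mult_d_def fourier_d_def inv_fourier_modulate)
  finally show ?thesis .
qed

lemma shifted_block_Lp_qnorm:
  fixes \<psi>0 m :: "real^'n::finite \<Rightarrow> real"
  assumes \<psi>: "admissible_iso \<psi>0" and f: "tempered f"
    and m: "smooth (\<lambda>x. complex_of_real (m x))" "\<And>x. norm x > R \<Longrightarrow> m x = 0"
    and mJ: "\<And>j x. psi \<psi>0 j x \<noteq> 0 \<Longrightarrow> m (x + freq_shift j) = (if j = j0 then 1 else 0)"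
  shows "Lp_qnorm_d p (inv_fourier_d (mult_d m (fourier_d (shifted \<psi>0 f)))) =
    Lp_qnorm_d p (inv_fourier_d (mult_d (psi \<psi>0 j0) (fourier_d f)))"
  using shifted_block[OF \<psi> f _ m, where J="{j0}"] mJ
  by (intro Lp_qnorm_d_modulate[OF \<psi>, where a="freq_shift j0"]) auto

lemma shifted_block_Lp_qnorm_zero:
  fixes \<psi>0 m :: "real^'n::finite \<Rightarrow> real"
  assumes \<psi>: "admissible_iso \<psi>0" and f: "tempered f"
    and m: "smooth (\<lambda>x. complex_of_real (m x))" "\<And>x. norm x > R \<Longrightarrow> m x = 0"
    and mJ: "\<And>j x. psi \<psi>0 j x \<noteq> 0 \<Longrightarrow> m (x + freq_shift j) = 0"
  shows "Lp_qnorm_d p (inv_fourier_d (mult_d m (fourier_d (shifted \<psi>0 f)))) = 0"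
  using shifted_block[OF \<psi> f _ m, where J="{}"] mJ by (intro Lp_qnorm_d_zero[OF \<psi>]) auto

lemma besov_qnorm_shifted:
  fixes \<psi>0 :: "real^'n::finite \<Rightarrow> real"
  assumes \<psi>: "admissible_iso \<psi>0" and f: "tempered f" and q: "0 < q"
  shows "besov_qnorm \<psi>0 s p q (shifted \<psi>0 f) = ennreal (2 powr (4 * s)) * besov_qnorm \<psi>0 s p q f"
  unfolding besov_qnorm_def
proof (rule lq_qnorm_reindex[where \<iota>="\<lambda>j. j + 4"])
  fix j :: nat
  have "Lp_qnorm_d p (inv_fourier_d (mult_d (psi \<psi>0 (j + 4)) (fourier_d (shifted \<psi>0 f)))) =
      Lp_qnorm_d p (inv_fourier_d (mult_d (psi \<psi>0 j) (fourier_d f)))"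
    by (rule shifted_block_Lp_qnorm[OF \<psi> f smooth_psi[OF \<psi>]], erule psi_compact_support[OF \<psi>])
       (auto simp: psi_shift[OF \<psi>])
  moreover have "(2::real) powr (real (j + 4) * s) = 2 powr (4 * s) * 2 powr (real j * s)"
    by (simp add: powr_add[symmetric] algebra_simps)
  ultimately show "ennreal (2 powr (real (j + 4) * s)) *
      Lp_qnorm_d p (inv_fourier_d (mult_d (psi \<psi>0 (j + 4)) (fourier_d (shifted \<psi>0 f)))) =
      ennreal (2 powr (4 * s)) * (ennreal (2 powr (real j * s)) *
      Lp_qnorm_d p (inv_fourier_d (mult_d (psi \<psi>0 j) (fourier_d f))))"
    by (simp add: ennreal_mult mult.assoc)
next
  \<comment> \<open>These are the indices below 4, which no translated block reaches.\<close>
  fix k :: nat assume k: "k \<notin> range (\<lambda>j. j + 4)"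
  have "Lp_qnorm_d p (inv_fourier_d (mult_d (psi \<psi>0 k) (fourier_d (shifted \<psi>0 f)))) = 0"
    by (rule shifted_block_Lp_qnorm_zero[OF \<psi> f smooth_psi[OF \<psi>]], erule psi_compact_support[OF \<psi>])
       (use k in \<open>auto simp: psi_shift[OF \<psi>]\<close>)
  then show "ennreal (2 powr (real k * s)) *
      Lp_qnorm_d p (inv_fourier_d (mult_d (psi \<psi>0 k) (fourier_d (shifted \<psi>0 f)))) = 0" by simp
qed (use q in auto)

lemma mixed_qnorm_shifted:
  fixes \<psi>0 :: "real^'n::finite \<Rightarrow> real"
  assumes \<psi>: "admissible_iso \<psi>0" and \<phi>: "admissible_1d \<phi>0" and f: "tempered f" and q: "0 < q"
  shows "mixed_qnorm \<phi>0 t p q (shifted \<psi>0 f) =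
    ennreal (2 powr (4 * (t * real CARD('n)))) * besov_qnorm \<psi>0 (t * real CARD('n)) p q f"
  unfolding mixed_qnorm_def besov_qnorm_def
proof (rule lq_qnorm_reindex[where \<iota>="\<lambda>j _. j + 4"])
  show "inj (\<lambda>j (_ :: 'n). j + (4::nat))" by (auto simp: inj_def fun_eq_iff)
  fix j :: nat
  have "Lp_qnorm_d p (inv_fourier_d (mult_d (phi_mixed \<phi>0 (\<lambda>_. j + 4)) (fourier_d (shifted \<psi>0 f)))) =
      Lp_qnorm_d p (inv_fourier_d (mult_d (psi \<psi>0 j) (fourier_d f)))"
    by (rule shifted_block_Lp_qnorm[OF \<psi> f smooth_phi_mixed[OF \<phi>]], erule phi_mixed_compact_support[OF \<phi>])
       (auto simp: phi_mixed_shift[OF \<psi> \<phi>] fun_eq_iff)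
  \<comment> \<open>The diagonal multi-index has |k| = d (j+4), so the mixed weight with exponent t
    is the isotropic weight with exponent t d at j+4.\<close>
  moreover have "(2::real) powr (real (\<Sum>i\<in>(UNIV :: 'n set). j + 4) * t) =
      2 powr (4 * (t * real CARD('n))) * 2 powr (real j * (t * real CARD('n)))"
    by (simp add: powr_add[symmetric] algebra_simps)
  ultimately show "ennreal (2 powr (real (\<Sum>i\<in>(UNIV :: 'n set). j + 4) * t)) *
      Lp_qnorm_d p (inv_fourier_d (mult_d (phi_mixed \<phi>0 (\<lambda>_. j + 4)) (fourier_d (shifted \<psi>0 f)))) =
      ennreal (2 powr (4 * (t * real CARD('n)))) * (ennreal (2 powr (real j * (t * real CARD('n)))) *
      Lp_qnorm_d p (inv_fourier_d (mult_d (psi \<psi>0 j) (fourier_d f))))"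
    by (simp only: ennreal_mult powr_ge_zero mult.assoc)
next
  \<comment> \<open>Off-diagonal indices and constant ones below 4.\<close>
  fix k :: "'n \<Rightarrow> nat" assume k: "k \<notin> range (\<lambda>j _. j + 4)"
  have "Lp_qnorm_d p (inv_fourier_d (mult_d (phi_mixed \<phi>0 k) (fourier_d (shifted \<psi>0 f)))) = 0"
    by (rule shifted_block_Lp_qnorm_zero[OF \<psi> f smooth_phi_mixed[OF \<phi>]], erule phi_mixed_compact_support[OF \<phi>])
       (use k in \<open>auto simp: phi_mixed_shift[OF \<psi> \<phi>]\<close>)
  then show "ennreal (2 powr (real (\<Sum>i\<in>UNIV. k i) * t)) *
      Lp_qnorm_d p (inv_fourier_d (mult_d (phi_mixed \<phi>0 k) (fourier_d (shifted \<psi>0 f)))) = 0" by simp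
qed (use q in auto)

theorem theorem3p10:
  fixes \<psi>0 :: "real^'n::finite \<Rightarrow> real" and \<phi>0 :: "real \<Rightarrow> real"
    and p q p0 q0 :: ennreal and t t0 :: real
  assumes "admissible_iso \<psi>0" and "admissible_1d \<phi>0"
    and "0 < p" and "0 < q" and "0 < p0" and "0 < q0"
    and "embeds (besov \<psi>0 t0 p0 q0) (besov_qnorm \<psi>0 t0 p0 q0)
                (mixed_besov \<phi>0 t p q) (mixed_qnorm \<phi>0 t p q)"
  shows "embeds (besov \<psi>0 t0 p0 q0) (besov_qnorm \<psi>0 t0 p0 q0)
                (besov \<psi>0 (t * real CARD('n)) p q) (besov_qnorm \<psi>0 (t * real CARD('n)) p q)"
proof -
  define s where "s = t * real CARD('n)"
  obtain C where C: "0 \<le> C" and emb: "\<And>g. g \<in> besov \<psi>0 t0 p0 q0 \<Longrightarrow>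
      mixed_qnorm \<phi>0 t p q g \<le> ennreal C * besov_qnorm \<psi>0 t0 p0 q0 g"
    using assms(7) unfolding embeds_def by blast
  \<comment> \<open>The index offset 4 costs 2^(4 t0) on the source side, and 2^(4 s) has to be
    cancelled on the target side; multiplying by 2^(-4 s) replaces a division in
    \<open>ennreal\<close>.\<close>
  define D where "D = 2 powr (- 4 * s) * (C * 2 powr (4 * t0))"
  have D: "0 \<le> D" using C by (simp add: D_def)
  have bound: "besov_qnorm \<psi>0 s p q f \<le> ennreal D * besov_qnorm \<psi>0 t0 p0 q0 f"
    and fin: "tempered f" "besov_qnorm \<psi>0 t0 p0 q0 f < top"
    if f: "f \<in> besov \<psi>0 t0 p0 q0" for f
  proof -
    show ft: "tempered f" and ff: "besov_qnorm \<psi>0 t0 p0 q0 f < top" using f by (auto simp: besov_def)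
    have "shifted \<psi>0 f \<in> besov \<psi>0 t0 p0 q0"
      using shifted_tempered[OF assms(1) ft] ff
      by (simp add: besov_def besov_qnorm_shifted[OF assms(1) ft assms(6)] ennreal_mult_less_top)
    from emb[OF this] have *: "ennreal (2 powr (4 * s)) * besov_qnorm \<psi>0 s p q f \<le>
        ennreal C * (ennreal (2 powr (4 * t0)) * besov_qnorm \<psi>0 t0 p0 q0 f)"
      by (simp only: mixed_qnorm_shifted[OF assms(1,2) ft assms(4)] besov_qnorm_shifted[OF assms(1) ft assms(6)] s_def)
    have "besov_qnorm \<psi>0 s p q f = ennreal (2 powr (- 4 * s)) * (ennreal (2 powr (4 * s)) * besov_qnorm \<psi>0 s p q f)"
      by (simp add: mult.assoc[symmetric] ennreal_mult[symmetric] powr_add[symmetric])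
    also have "\<dots> \<le> ennreal (2 powr (- 4 * s)) * (ennreal C * (ennreal (2 powr (4 * t0)) * besov_qnorm \<psi>0 t0 p0 q0 f))"
      using * by (rule mult_left_mono) simp
    also have "\<dots> = ennreal D * besov_qnorm \<psi>0 t0 p0 q0 f"
      using C by (simp add: D_def ennreal_mult mult.assoc)
    finally show "besov_qnorm \<psi>0 s p q f \<le> ennreal D * besov_qnorm \<psi>0 t0 p0 q0 f" .
  qed
  have "f \<in> besov \<psi>0 s p q" if f: "f \<in> besov \<psi>0 t0 p0 q0" for f
    using fin[OF f] le_less_trans[OF bound[OF f]] by (simp add: besov_def ennreal_mult_less_top)
  then show ?thesis
    unfolding embeds_def s_def[symmetric] using bound D by blast
qed

end
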